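(* Let $\mathcal{H}$ be a complex Hilbert space and let $A, B, C, D \in \mathcal{B}(\mathcal{H})$. Then for every real $r \geq 1$, $$w^{2r}(A^*B+ C^*D) \leq 2^{2r-3} \left\||A|^{4r} + |B|^{4r} + |C|^{4r} + |D|^{4r} \right\| + 2^{2r-2} \left(w^r\left(|B|^2|A|^2 \right) +w^r\left(|D|^2|C|^2 \right) \right).$$
   Context: $\mathcal{B}(\mathcal{H})$ is the $C^*$-algebra of all bounded linear operators on $\mathcal{H}$; $\|\cdot\|$ is the operator norm. For $T\in\mathcal{B}(\mathcal{H})$, $|T| = (T^*T)^{1/2}$; real powers of positive operators are taken by continuous functional calculus. The numerical radius is $w(T) = \sup_{\|x\|=1} |\langle Tx, x\rangle|$, and $w^p(T)$ denotes $(w(T))^p$. *)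

theory Defs
  imports "HOL-Analysis.Analysis" "HOL-Computational_Algebra.Polynomial"
begin

text \<open>Complex inner product spaces; the inner product is linear in its first argument.
  The class extends \<open>real_normed_vector\<close>, so that the topology, \<open>bounded_linear\<close> and
  \<open>onorm\<close> of the library refer to the norm induced by the inner product.\<close>

class complex_inner = real_normed_vector +
  fixes scaleC :: "complex \<Rightarrow> 'a \<Rightarrow> 'a"  (infixr "*\<^sub>C" 75)
    and cinner :: "'a \<Rightarrow> 'a \<Rightarrow> complex"
  assumes scaleC_add_right: "a *\<^sub>C (x + y) = a *\<^sub>C x + a *\<^sub>C y"
    and scaleC_add_left: "(a + b) *\<^sub>C x = a *\<^sub>C x + b *\<^sub>C x"
    and scaleC_scaleC: "a *\<^sub>C (b *\<^sub>C x) = (a * b) *\<^sub>C x"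
    and scaleR_scaleC: "scaleR r x = complex_of_real r *\<^sub>C x"
    and cinner_commute: "cinner x y = cnj (cinner y x)"
    and cinner_add_left: "cinner (x + y) z = cinner x z + cinner y z"
    and cinner_scaleC_left: "cinner (a *\<^sub>C x) y = a * cinner x y"
    and norm_sq_cinner: "complex_of_real ((norm x)\<^sup>2) = cinner x x"

class complex_hilbert_space = complex_inner + complete_space
begin

subclass banach ..

end

definition bounded_clinear :: "('a::complex_inner \<Rightarrow> 'a) \<Rightarrow> bool" where
  "bounded_clinear T \<longleftrightarrow> bounded_linear T \<and> (\<forall>a x. T (a *\<^sub>C x) = a *\<^sub>C T x)"

definition cadjoint :: "('a::complex_hilbert_space \<Rightarrow> 'a) \<Rightarrow> ('a \<Rightarrow> 'a)" where
  "cadjoint T = (THE S. \<forall>x y. cinner (T x) y = cinner x (S y))"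

text \<open>The inserted \<open>0\<close> only matters on the zero space, where there are no unit vectors: it
  makes the supremum of the empty set of nonnegative reals \<open>0\<close>.\<close>

definition numerical_radius :: "('a::complex_inner \<Rightarrow> 'a) \<Rightarrow> real" where
  "numerical_radius T = Sup (insert 0 {cmod (cinner (T x) x) | x. norm x = 1})"

definition spectrum :: "('a::complex_inner \<Rightarrow> 'a) \<Rightarrow> complex set" where
  "spectrum T = {z. \<not> (\<exists>S. bounded_clinear S \<and>
     (\<forall>x. S (T x - z *\<^sub>C x) = x) \<and> (\<forall>x. T (S x) - z *\<^sub>C S x = x))}"

definition poly_op :: "real poly \<Rightarrow> ('a::real_vector \<Rightarrow> 'a) \<Rightarrow> ('a \<Rightarrow> 'a)" where
  "poly_op p T = (\<lambda>x. \<Sum>i\<le>degree p. coeff p i *\<^sub>R (T ^^ i) x)"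

text \<open>Continuous functional calculus for a self-adjoint \<open>T\<close>, whose spectrum is a compact set of
  reals, and a real function \<open>f\<close> continuous on it: \<open>f(T)\<close> is the limit in operator norm of
  \<open>p\<^sub>n(T)\<close>, for every sequence of polynomials \<open>p\<^sub>n\<close> that converges to \<open>f\<close> uniformly on the
  spectrum. Only meaningful for such \<open>T\<close> and \<open>f\<close>.\<close>

definition cfc :: "(real \<Rightarrow> real) \<Rightarrow> ('a::complex_hilbert_space \<Rightarrow> 'a) \<Rightarrow> ('a \<Rightarrow> 'a)" where
  "cfc f T = (THE S. bounded_clinear S \<and>
     (\<forall>p :: nat \<Rightarrow> real poly.
        uniform_limit {t. complex_of_real t \<in> spectrum T} (\<lambda>n. poly (p n)) f sequentially \<longrightarrow>
        (\<lambda>n. onorm (\<lambda>x. poly_op (p n) T x - S x)) \<longlonglongrightarrow> 0))"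

text \<open>Real powers of a positive operator; only meant for exponents \<open>s > 0\<close>, where
  \<open>t powr s\<close> is continuous on \<open>[0, \<infinity>)\<close> (with \<open>0 powr s = 0\<close>).\<close>

definition op_powr :: "('a::complex_hilbert_space \<Rightarrow> 'a) \<Rightarrow> real \<Rightarrow> ('a \<Rightarrow> 'a)" where
  "op_powr T s = cfc (\<lambda>t. t powr s) T"

definition op_abs :: "('a::complex_hilbert_space \<Rightarrow> 'a) \<Rightarrow> ('a \<Rightarrow> 'a)" where
  "op_abs T = op_powr (cadjoint T \<circ> T) (1/2)"

end

theory Submission
  imports Defs "HOL-Computational_Algebra.Fundamental_Theorem_Algebra"
begin

text \<open>
  For a unit vector \<open>x\<close>, the quantity \<open>\<bar>\<langle>A\<^sup>*B x, x\<rangle>\<bar>\<^sup>2\<close> is at most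
  \<open>\<parallel>A x\<parallel>\<^sup>2 \<parallel>B x\<parallel>\<^sup>2 = \<langle>\<bar>A\<bar>\<^sup>2 x, x\<rangle> \<langle>x, \<bar>B\<bar>\<^sup>2 x\<rangle>\<close>, which Buzano's inequality bounds by
  \<open>(\<parallel>\<bar>A\<bar>\<^sup>2 x\<parallel> \<parallel>\<bar>B\<bar>\<^sup>2 x\<parallel> + \<bar>\<langle>\<bar>B\<bar>\<^sup>2 \<bar>A\<bar>\<^sup>2 x, x\<rangle>\<bar>) / 2\<close>. Convexity of \<open>t \<mapsto> t powr r\<close>, the AM-GM
  inequality and McCarthy's inequality \<open>\<langle>P\<^sup>4 x, x\<rangle> powr r \<le> \<langle>P powr (4 r) x, x\<rangle>\<close> turn this into a
  bound of \<open>\<bar>\<langle>A\<^sup>*B x, x\<rangle>\<bar> powr (2 r)\<close>; the same for \<open>C\<close> and \<open>D\<close> and convexity of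
  \<open>t \<mapsto> t powr (2 r)\<close> give the theorem. The functional calculus rests on the bound
  \<open>\<parallel>p(T)\<parallel> \<le> sup \<bar>p\<bar>\<close> over the spectrum of a self-adjoint \<open>T\<close>, for real polynomials \<open>p\<close>.
\<close>

section \<open>Complex inner products\<close>

lemma cinner_add_right: "cinner x (y + z) = cinner x y + cinner x (z::'a::complex_inner)"
  by (metis cinner_add_left cinner_commute complex_cnj_add)

lemma cinner_scaleC_right: "cinner x (a *\<^sub>C y) = cnj a * cinner x (y::'a::complex_inner)"
  by (metis cinner_scaleC_left cinner_commute complex_cnj_mult)

lemma cinner_scaleR_left: "cinner (a *\<^sub>R x) y = of_real a * cinner x (y::'a::complex_inner)"
  by (simp add: scaleR_scaleC cinner_scaleC_left)

lemma cinner_scaleR_right: "cinner x (a *\<^sub>R y) = of_real a * cinner x (y::'a::complex_inner)"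
  by (simp add: scaleR_scaleC cinner_scaleC_right)

lemma cinner_diff_left: "cinner (x - y) z = cinner x z - cinner y (z::'a::complex_inner)"
  by (metis cinner_add_left diff_add_cancel eq_diff_eq)

lemma cinner_diff_right: "cinner z (x - y) = cinner z x - cinner z (y::'a::complex_inner)"
  by (metis cinner_add_right diff_add_cancel eq_diff_eq)

lemma cinner_zero_left [simp]: "cinner 0 (y::'a::complex_inner) = 0"
  using cinner_diff_left[of y y y] by simp

lemma cinner_zero_right [simp]: "cinner (y::'a::complex_inner) 0 = 0"
  using cinner_diff_right[of y y y] by simp

lemmas cinner_algebra = cinner_add_left cinner_add_right cinner_diff_left cinner_diff_right
  cinner_scaleC_left cinner_scaleC_right cinner_scaleR_left cinner_scaleR_right

lemma scaleC_diff_right: "a *\<^sub>C (x - y) = a *\<^sub>C x - a *\<^sub>C (y::'a::complex_inner)"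
  by (metis scaleC_add_right diff_add_cancel eq_diff_eq)

lemma scaleC_diff_left: "(a - b) *\<^sub>C x = a *\<^sub>C x - b *\<^sub>C (x::'a::complex_inner)"
  by (metis scaleC_add_left diff_add_cancel eq_diff_eq)

lemma scaleC_zero_left [simp]: "0 *\<^sub>C (x::'a::complex_inner) = 0"
  using scaleC_diff_left[of 0 0 x] by simp

lemma scaleC_zero_right [simp]: "a *\<^sub>C (0::'a::complex_inner) = 0"
  using scaleC_diff_right[of a 0 0] by simp

lemma scaleC_one [simp]: "1 *\<^sub>C (x::'a::complex_inner) = x"
  using scaleR_scaleC[of 1 x] by simp

lemma cinner_self: "cinner x x = of_real ((norm (x::'a::complex_inner))\<^sup>2)"
  by (simp only: norm_sq_cinner)

lemma norm_sq_Re: "(norm (x::'a::complex_inner))\<^sup>2 = Re (cinner x x)"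
  by (simp only: cinner_self Re_complex_of_real)

lemma Re_cinner_commute: "Re (cinner x y) = Re (cinner y (x::'a::complex_inner))"
  by (metis cinner_commute complex_cnj(1) complex.sel(1) cnj.simps(1))

lemma norm_add_sq:
  "(norm (x + y))\<^sup>2 = (norm x)\<^sup>2 + (norm y)\<^sup>2 + 2 * Re (cinner x (y::'a::complex_inner))"
  using Re_cinner_commute[of x y] by (simp add: norm_sq_Re cinner_algebra)

lemma norm_diff_sq:
  "(norm (x - y))\<^sup>2 = (norm x)\<^sup>2 + (norm y)\<^sup>2 - 2 * Re (cinner x (y::'a::complex_inner))"
  using Re_cinner_commute[of x y] by (simp add: norm_sq_Re cinner_algebra)

lemma norm_scaleC: "norm (a *\<^sub>C x) = cmod a * norm (x::'a::complex_inner)"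
proof -
  have "complex_of_real ((norm (a *\<^sub>C x))\<^sup>2) = (a * cnj a) * of_real ((norm x)\<^sup>2)"
    unfolding norm_sq_cinner by (simp add: cinner_algebra)
  also have "\<dots> = of_real ((cmod a * norm x)\<^sup>2)"
    by (simp only: complex_norm_square[symmetric] power_mult_distrib of_real_mult of_real_power)
  finally have "(norm (a *\<^sub>C x))\<^sup>2 = (cmod a * norm x)\<^sup>2"
    using of_real_eq_iff by blast
  then show ?thesis by simp
qed

text \<open>The vector \<open>n x - c y\<close> is \<open>n\<close> times the component of
  \<open>x\<close> orthogonal to \<open>y\<close>, and its squared norm is nonnegative. Scaling by
  \<open>n\<close> postpones the division.\<close>

lemma cinner_Cauchy_Schwarz: "cmod (cinner x y) \<le> norm x * norm (y::'a::complex_inner)"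
proof (cases "y = 0")
  case False
  define c where "c = cinner x y"
  define n where "n = (norm y)\<^sup>2"
  have n: "n > 0" using False by (simp add: n_def)
  have "cinner (n *\<^sub>R x) (c *\<^sub>C y) = of_real n * (c * cnj c)"
    by (simp add: cinner_algebra c_def mult.commute)
  also have "\<dots> = of_real (n * (cmod c)\<^sup>2)"
    by (simp only: complex_norm_square[symmetric] of_real_mult)
  finally have *: "Re (cinner (n *\<^sub>R x) (c *\<^sub>C y)) = n * (cmod c)\<^sup>2"
    by (simp only: Re_complex_of_real)
  have "0 \<le> (norm (n *\<^sub>R x - c *\<^sub>C y))\<^sup>2" by simp
  also have "\<dots> = n\<^sup>2 * (norm x)\<^sup>2 + (cmod c)\<^sup>2 * n - 2 * (n * (cmod c)\<^sup>2)"
    unfolding norm_diff_sq * norm_scaleC norm_scaleR power_mult_distrib power2_abs n_def[symmetric] ..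
  also have "\<dots> = n * (n * (norm x)\<^sup>2 - (cmod c)\<^sup>2)"
    by (simp add: power2_eq_square right_diff_distrib)
  finally have "(cmod c)\<^sup>2 \<le> n * (norm x)\<^sup>2"
    using n by (simp add: zero_le_mult_iff)
  then have "(cmod c)\<^sup>2 \<le> (norm x * norm y)\<^sup>2"
    by (simp add: n_def power_mult_distrib mult.commute)
  then show ?thesis unfolding c_def by (rule power2_le_imp_le) simp
qed simp

lemma Re_cinner_le: "Re (cinner x y) \<le> norm x * norm (y::'a::complex_inner)"
  using cinner_Cauchy_Schwarz[of x y] complex_Re_le_cmod[of "cinner x y"] by linarith

lemma bounded_linear_cinner_left: "bounded_linear (\<lambda>x. cinner x (y::'a::complex_inner))"
  by (rule bounded_linear_intro[where K = "norm y"])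
    (auto simp: cinner_algebra cinner_Cauchy_Schwarz scaleR_conv_of_real)

lemma cinner_ext: "(\<And>x. cinner x y = cinner x z) \<Longrightarrow> y = (z::'a::complex_inner)"
  using norm_sq_cinner[of "y - z"] by (simp add: cinner_diff_right)

text \<open>The reflection of \<open>b\<close> in the line spanned by \<open>e\<close> has the norm of \<open>b\<close>, so this is
  Cauchy--Schwarz for \<open>a\<close> and that reflection.\<close>

lemma Buzano:
  fixes a b e :: "'a::complex_inner"
  assumes "norm e = 1"
  shows "cmod (cinner a e * cinner e b) \<le> (norm a * norm b + cmod (cinner a b)) / 2"
proof -
  define u where "u = 2 *\<^sub>R (cinner b e *\<^sub>C e) - b"
  have ee: "cinner e e = 1" using assms by (simp add: cinner_self)
  have eb: "cinner e b = cnj (cinner b e)" by (rule cinner_commute)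
  have "(norm u)\<^sup>2 = (norm b)\<^sup>2"
    using cmod_power2[of "cinner b e"] unfolding u_def norm_diff_sq
    by (simp add: cinner_algebra norm_scaleC assms power_mult_distrib eb power2_eq_square)
  then have "norm u = norm b" by simp
  moreover have "2 * (cinner a e * cinner e b) = cinner a u + cinner a b"
    by (simp add: u_def cinner_algebra eb)
  then have "2 * cmod (cinner a e * cinner e b) \<le> cmod (cinner a u) + cmod (cinner a b)"
    by (metis norm_mult norm_numeral norm_triangle_ineq)
  ultimately show ?thesis using cinner_Cauchy_Schwarz[of a u] by simp
qed

section \<open>Bounded operators and adjoints\<close>

lemma bounded_clinear_linear: "bounded_clinear T \<Longrightarrow> bounded_linear T"
  by (simp add: bounded_clinear_def)

lemma bounded_clinear_scaleC: "bounded_clinear T \<Longrightarrow> T (a *\<^sub>C x) = a *\<^sub>C T x"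
  by (simp add: bounded_clinear_def)

lemma bounded_clinear_add: "bounded_clinear T \<Longrightarrow> T (x + y) = T x + T y"
  by (simp add: bounded_clinear_def bounded_linear.linear linear_add)

lemma bounded_clinear_diff: "bounded_clinear T \<Longrightarrow> T (x - y) = T x - T y"
  by (simp add: bounded_clinear_def bounded_linear.linear linear_diff)

lemma bounded_clinear_zero: "bounded_clinear T \<Longrightarrow> T 0 = 0"
  by (simp add: bounded_clinear_def bounded_linear.linear linear_0)

lemma bounded_clinear_norm: "bounded_clinear T \<Longrightarrow> norm (T x) \<le> onorm T * norm x"
  by (simp add: bounded_clinear_def onorm)

lemma bounded_clinear_onorm_pos: "bounded_clinear T \<Longrightarrow> 0 \<le> onorm T"
  by (simp add: bounded_clinear_def onorm_pos_le)

lemma bounded_clinear_intro: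
  assumes "\<And>x y. T (x + y) = T x + T y" "\<And>a x. T (a *\<^sub>C x) = a *\<^sub>C T x"
    and "\<And>x. norm (T x) \<le> norm x * K"
  shows "bounded_clinear T"
  unfolding bounded_clinear_def
  by (auto intro!: bounded_linear_intro[where K = K] simp: assms scaleR_scaleC)

lemma bounded_clinear_comp: "bounded_clinear S \<Longrightarrow> bounded_clinear T \<Longrightarrow> bounded_clinear (\<lambda>x. S (T x))"
  by (simp add: bounded_clinear_def bounded_linear_compose)

lemma bounded_clinear_plus: "bounded_clinear S \<Longrightarrow> bounded_clinear T \<Longrightarrow> bounded_clinear (\<lambda>x. S x + T x)"
  by (simp add: bounded_clinear_def bounded_linear_add scaleC_add_right)

lemma bounded_clinear_minus: "bounded_clinear S \<Longrightarrow> bounded_clinear T \<Longrightarrow> bounded_clinear (\<lambda>x. S x - T x)"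
  by (simp add: bounded_clinear_def bounded_linear_sub scaleC_diff_right)

lemma bounded_clinear_ident: "bounded_clinear (\<lambda>x. x)"
  by (simp add: bounded_clinear_def bounded_linear_ident)

lemma bounded_clinear_zero_fun: "bounded_clinear (\<lambda>x. 0)"
  by (simp add: bounded_clinear_def bounded_linear_zero)

lemma bounded_clinear_scale:
  assumes T: "bounded_clinear T"
  shows "bounded_clinear (\<lambda>x. a *\<^sub>C T x)"
proof (rule bounded_clinear_intro)
  show "norm (a *\<^sub>C T x) \<le> norm x * (cmod a * onorm T)" for x
    using mult_left_mono[OF bounded_clinear_norm[OF T, of x], of "cmod a"]
    by (simp add: norm_scaleC mult.commute mult.left_commute)
qed (simp_all add: bounded_clinear_add[OF T] bounded_clinear_scaleC[OF T] scaleC_add_right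
    scaleC_scaleC mult.commute)

lemmas bounded_clinear_intros = bounded_clinear_plus bounded_clinear_minus
  bounded_clinear_ident bounded_clinear_zero_fun bounded_clinear_scale

text \<open>The representing vector minimizes \<open>\<parallel>x\<parallel>\<^sup>2 - 2 Re (f x)\<close>; the parallelogram law makes every
  minimizing sequence a Cauchy sequence.\<close>

lemma Riesz_representation:
  fixes f :: "'a::complex_hilbert_space \<Rightarrow> complex"
  assumes f: "bounded_linear f" and fC: "\<And>a x. f (a *\<^sub>C x) = a * f x"
  obtains z where "\<And>x. f x = cinner x z"
proof -
  interpret f: bounded_linear f by fact
  define J where "J x = (norm x)\<^sup>2 - 2 * Re (f x)" for x
  obtain K where K: "\<And>x. norm (f x) \<le> norm x * K" using f.bounded by blast
  \<comment> \<open>Completing the square: \<open>J x\<close> is at least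
    \<open>(norm x - K)^2 - K^2\<close>.\<close>
  have lower: "- (K\<^sup>2) \<le> J x" for x
  proof -
    have "Re (f x) \<le> norm x * K" using K[of x] complex_Re_le_cmod[of "f x"] by linarith
    moreover have "0 \<le> (norm x - K)\<^sup>2" by simp
    ultimately show ?thesis unfolding J_def power2_diff by linarith
  qed
  define m where "m = Inf (range J)"
  have bdd: "bdd_below (range J)" using lower by (auto intro!: bdd_belowI)
  have m: "m \<le> J x" for x unfolding m_def using bdd by (simp add: cInf_lower)
  \<comment> \<open>The parallelogram law, with \<open>m\<close> as a lower bound of
    \<open>J\<close> at the midpoint: nearly minimal values force nearby points.\<close>
  have para: "(norm (x - y))\<^sup>2 \<le> 2 * J x + 2 * J y - 4 * m" for x y
  proof -
    have "J ((1/2) *\<^sub>R (x + y)) = (norm (x + y))\<^sup>2 / 4 - (Re (f x) + Re (f y))"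
      unfolding J_def f.scaleR f.add norm_scaleR power_mult_distrib by (simp add: field_simps)
    then have "4 * J ((1/2) *\<^sub>R (x + y)) = 2 * J x + 2 * J y - (norm (x - y))\<^sup>2"
      by (simp add: J_def norm_add_sq norm_diff_sq)
    then show ?thesis using m[of "(1/2) *\<^sub>R (x + y)"] by linarith
  qed
  have "\<exists>x. J x < m + 1 / real (Suc n)" for n
    using cInf_lessD[of "range J" "m + 1 / real (Suc n)"] by (auto simp: m_def)
  then obtain X where X: "\<And>n. J (X n) < m + 1 / real (Suc n)" by metis
  have "Cauchy X"
  proof (rule metric_CauchyI)
    fix e :: real assume "e > 0"
    \<comment> \<open>In \<open>para\<close> two excesses over \<open>m\<close>, each below
      \<open>1 / Suc N\<close>, are counted twice; this gives the constant 4.\<close>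
    then obtain N where N: "4 / e\<^sup>2 < real (Suc N)"
      by (meson lessI less_trans of_nat_less_iff reals_Archimedean2)
    have "dist (X i) (X j) < e" if "i \<ge> N" "j \<ge> N" for i j
    proof -
      have le: "1 / real (Suc k) \<le> 1 / real (Suc N)" if "k \<ge> N" for k
        using that by (simp add: frac_le)
      have "(norm (X i - X j))\<^sup>2 < 4 * (1 / real (Suc N))"
        using para[of "X i" "X j"] X[of i] X[of j] le[OF that(1)] le[OF that(2)] by linarith
      also have "\<dots> < e\<^sup>2" using N \<open>e > 0\<close> by (simp add: field_simps)
      finally show ?thesis
        unfolding dist_norm by (rule power2_less_imp_less) (use \<open>e > 0\<close> in simp)
    qed
    then show "\<exists>M. \<forall>i\<ge>M. \<forall>j\<ge>M. dist (X i) (X j) < e" by blast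
  qed
  then obtain z where z: "X \<longlonglongrightarrow> z" by (auto simp: Cauchy_convergent_iff convergent_def)
  have "(\<lambda>n. J (X n)) \<longlonglongrightarrow> J z"
    unfolding J_def by (intro tendsto_intros z f.tendsto)
  moreover have "(\<lambda>n. m + 1 / real (Suc n)) \<longlonglongrightarrow> m + 0"
    by (intro tendsto_intros LIMSEQ_Suc lim_inverse_n'[THEN LIMSEQ_Suc])
  ultimately have "J z \<le> m + 0" using X by (meson LIMSEQ_le less_imp_le)
  then have min: "J z \<le> J x" for x using m[of x] by simp
  have Re0: "Re (cinner v z) = Re (f v)" for v
  proof -
    define d where "d = Re (cinner v z) - Re (f v)"
    define n where "n = (norm v)\<^sup>2 + 1"
    have n: "n > 0" by (simp add: n_def add_nonneg_pos)
    \<comment> \<open>The minimizer of \<open>t^2 n + 2 t d\<close>; the \<open>+ 1\<close> in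
      \<open>n\<close> keeps the denominator positive for \<open>v = 0\<close>.\<close>
    define t where "t = - d / n"
    have "0 \<le> J (z + t *\<^sub>R v) - J z" using min by simp
    also have "\<dots> = t\<^sup>2 * (norm v)\<^sup>2 + 2 * t * d"
      using Re_cinner_commute[of v z]
      by (simp add: J_def d_def norm_add_sq power_mult_distrib f.add f.scaleR cinner_algebra algebra_simps)
    also have "\<dots> \<le> t\<^sup>2 * n + 2 * t * d" by (simp add: n_def algebra_simps)
    also have "\<dots> = - (d\<^sup>2 / n)" using n by (simp add: t_def field_simps power2_eq_square)
    finally have "d\<^sup>2 / n \<le> 0" by simp
    then have "d\<^sup>2 \<le> 0" using n by (simp add: divide_le_0_iff)
    then show ?thesis by (simp add: d_def)
  qed
  \<comment> \<open>Real parts suffice: multiplying \<open>x\<close> by the imaginary unit turns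
    imaginary parts into real ones.\<close>
  have "f x = cinner x z" for x
    using Re0[of x] Re0[of "\<i> *\<^sub>C x"] by (simp add: complex_eq_iff fC cinner_algebra)
  then show ?thesis by (rule that)
qed

text \<open>This justifies the description in \<open>cadjoint_def\<close>: Riesz gives a
  representing vector for each \<open>y\<close>, and nondegeneracy of the inner product makes it
  unique.\<close>

lemma cinner_cadjoint:
  assumes T: "bounded_clinear (T::'a::complex_hilbert_space \<Rightarrow> 'a)"
  shows "cinner (T x) y = cinner x (cadjoint T y)"
proof -
  have "\<exists>z. \<forall>x. cinner (T x) y = cinner x z" for y
  proof -
    have "bounded_linear (\<lambda>x. cinner (T x) y)"
      using bounded_linear_compose[OF bounded_linear_cinner_left bounded_clinear_linear[OF T]] .
    then show ?thesis
      using Riesz_representation[of "\<lambda>x. cinner (T x) y"]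
      by (auto simp: cinner_scaleC_left bounded_clinear_scaleC[OF T])
  qed
  then obtain S where S: "\<forall>x y. cinner (T x) y = cinner x (S y)" by metis
  have "\<forall>x y. cinner (T x) y = cinner x (cadjoint T y)"
    unfolding cadjoint_def
  proof (rule theI[where P = "\<lambda>S. \<forall>x y. cinner (T x) y = cinner x (S y)"])
    show "S' = S" if "\<forall>x y. cinner (T x) y = cinner x (S' y)" for S'
      using that S by (intro ext cinner_ext) auto
  qed (rule S)
  then show ?thesis by blast
qed

text \<open>For the bound, \<open>cadjoint T x\<close> is paired with itself: moving
  \<open>T\<close> across leaves one factor \<open>norm (cadjoint T x)\<close> to cancel.\<close>

lemma bounded_clinear_cadjoint:
  assumes T: "bounded_clinear (T::'a::complex_hilbert_space \<Rightarrow> 'a)"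
  shows "bounded_clinear (cadjoint T)"
proof (rule bounded_clinear_intro[where K = "onorm T"])
  note adj = cinner_cadjoint[OF T, symmetric]
  show "cadjoint T (x + y) = cadjoint T x + cadjoint T y" for x y
    by (rule cinner_ext) (simp add: cinner_algebra adj)
  show "cadjoint T (a *\<^sub>C x) = a *\<^sub>C cadjoint T x" for a x
    by (rule cinner_ext) (simp add: cinner_algebra adj)
  show "norm (cadjoint T x) \<le> norm x * onorm T" for x
  proof (cases "cadjoint T x = 0")
    case False
    let ?y = "cadjoint T x"
    have "(norm ?y)\<^sup>2 = Re (cinner (T ?y) x)" by (simp add: norm_sq_Re adj)
    also have "\<dots> \<le> norm (T ?y) * norm x" by (rule Re_cinner_le)
    also have "\<dots> \<le> onorm T * norm ?y * norm x"
      by (intro mult_right_mono bounded_clinear_norm T) auto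
    finally show ?thesis using False by (simp add: power2_eq_square mult.commute mult.left_commute)
  qed (use bounded_clinear_onorm_pos[OF T] in simp)
qed

section \<open>Polynomials in a self-adjoint operator\<close>

lemma bounded_clinear_inverse:
  assumes L: "bounded_clinear L" and "c > 0" and c: "\<And>x. c * norm x \<le> norm (L x)"
    and surj: "surj L"
  obtains S where "bounded_clinear S" "\<And>x. S (L x) = x" "\<And>x. L (S x) = x"
proof -
  \<comment> \<open>The lower bound makes \<open>L\<close> injective and bounds its inverse by
    \<open>1 / c\<close>; linearity of the inverse is checked after applying
    \<open>L\<close>.\<close>
  have inj: "x = y" if "L x = L y" for x y
    using c[of "x - y"] \<open>c > 0\<close> that by (simp add: bounded_clinear_diff[OF L] mult_le_0_iff)
  define S where "S = inv L"
  have LS: "L (S x) = x" for x by (simp add: S_def surj surj_f_inv_f)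
  have "bounded_clinear S"
  proof (rule bounded_clinear_intro)
    show "S (x + y) = S x + S y" for x y
      by (rule inj) (simp add: LS bounded_clinear_add[OF L])
    show "S (a *\<^sub>C x) = a *\<^sub>C S x" for a x
      by (rule inj) (simp add: LS bounded_clinear_scaleC[OF L])
    show "norm (S x) \<le> norm x * (1 / c)" for x
      using c[of "S x"] \<open>c > 0\<close> by (simp add: LS field_simps)
  qed
  moreover have "S (L x) = x" for x by (rule inj) (rule LS)
  ultimately show ?thesis using LS by (rule that)
qed

text \<open>Lax--Milgram: for small \<open>\<epsilon> > 0\<close>, coercivity makes \<open>x \<mapsto> x - \<epsilon> (L x - y)\<close> a contraction,
  whose fixed point solves \<open>L x = y\<close>.\<close>

lemma coercive_inverse:
  fixes L :: "'a::complex_hilbert_space \<Rightarrow> 'a"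
  assumes L: "bounded_clinear L" and "c > 0" and c: "\<And>x. c * (norm x)\<^sup>2 \<le> Re (cinner (L x) x)"
  obtains S where "bounded_clinear S" "\<And>x. S (L x) = x" "\<And>x. L (S x) = x"
proof -
  have below: "c * norm x \<le> norm (L x)" for x
  proof (cases "x = 0")
    case False
    have "c * norm x * norm x \<le> norm (L x) * norm x"
      using order_trans[OF c Re_cinner_le, of x] by (simp add: power2_eq_square mult.assoc)
    then show ?thesis using False by simp
  qed simp
  \<comment> \<open>The summand \<open>c\<close> ensures \<open>K > 0\<close> and
    \<open>c \<le> K\<close>, so that the square root below is that of a nonnegative number.\<close>
  define K where "K = onorm L + c"
  have K: "K > 0" "c \<le> K" "onorm L \<le> K"
    using bounded_clinear_onorm_pos[OF L] \<open>c > 0\<close> by (auto simp: K_def)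
  \<comment> \<open>This \<open>e\<close> minimizes \<open>1 - 2 e c + e^2 K^2\<close>, which bounds
    the squared contraction factor; the minimum is \<open>1 - c^2 / K^2\<close>.\<close>
  define e where "e = c / K\<^sup>2"
  have "e > 0" using K \<open>c > 0\<close> by (simp add: e_def)
  define k where "k = sqrt (1 - c\<^sup>2 / K\<^sup>2)"
  have cK: "c\<^sup>2 / K\<^sup>2 \<le> 1" "c\<^sup>2 / K\<^sup>2 > 0"
    using K \<open>c > 0\<close> by (auto simp: divide_le_eq_1 intro: power_mono)
  have k: "0 \<le> k" "k < 1" using cK by (auto simp: k_def)
  have k2: "k\<^sup>2 = 1 - c\<^sup>2 / K\<^sup>2" using cK by (simp add: k_def)
  have contr: "norm (z - e *\<^sub>R L z) \<le> k * norm z" for z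
  proof (rule power2_le_imp_le)
    have "norm (L z) \<le> K * norm z"
      by (rule order_trans[OF bounded_clinear_norm[OF L]]) (simp add: K mult_right_mono)
    then have "(norm (L z))\<^sup>2 \<le> K\<^sup>2 * (norm z)\<^sup>2"
      by (metis norm_ge_zero power_mono power_mult_distrib)
    then have 1: "e\<^sup>2 * (norm (L z))\<^sup>2 \<le> e\<^sup>2 * (K\<^sup>2 * (norm z)\<^sup>2)"
      by (simp add: mult_left_mono)
    have 2: "e * (c * (norm z)\<^sup>2) \<le> e * Re (cinner z (L z))"
      using c[of z] \<open>e > 0\<close> Re_cinner_commute[of z "L z"] by (simp add: mult_left_mono)
    have "(norm (z - e *\<^sub>R L z))\<^sup>2
        = (norm z)\<^sup>2 + e\<^sup>2 * (norm (L z))\<^sup>2 - 2 * (e * Re (cinner z (L z)))"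
      by (simp add: norm_diff_sq cinner_algebra power_mult_distrib)
    also have "\<dots> \<le> (norm z)\<^sup>2 + e\<^sup>2 * (K\<^sup>2 * (norm z)\<^sup>2) - 2 * (e * (c * (norm z)\<^sup>2))"
      using 1 2 by linarith
    also have "\<dots> = (k * norm z)\<^sup>2"
    proof -
      have "e\<^sup>2 * K\<^sup>2 = c\<^sup>2 / K\<^sup>2" "e * c = c\<^sup>2 / K\<^sup>2"
        using K by (simp_all add: e_def power2_eq_square)
      then show ?thesis
        by (simp add: power_mult_distrib k2 left_diff_distrib flip: mult.assoc)
    qed
    finally show "(norm (z - e *\<^sub>R L z))\<^sup>2 \<le> (k * norm z)\<^sup>2" .
  qed (use k in simp)
  have "\<exists>x. y = L x" for y
  proof -
    have "\<exists>!x. x - e *\<^sub>R (L x - y) = x"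
    proof (rule banach_fix_type[OF k], intro allI)
      fix x x'
      have "(x - e *\<^sub>R (L x - y)) - (x' - e *\<^sub>R (L x' - y)) = (x - x') - e *\<^sub>R L (x - x')"
        by (simp add: bounded_clinear_diff[OF L] scaleR_diff_right)
      then show "dist (x - e *\<^sub>R (L x - y)) (x' - e *\<^sub>R (L x' - y)) \<le> k * dist x x'"
        using contr[of "x - x'"] by (simp only: dist_norm)
    qed
    then show ?thesis using \<open>e > 0\<close> by auto
  qed
  then have "surj L" by (auto simp: surj_def)
  then show ?thesis using bounded_clinear_inverse[OF L \<open>c > 0\<close> below] that by blast
qed

section \<open>Self-adjoint operators and the real spectrum\<close>

definition self_adjoint :: "('a::complex_inner \<Rightarrow> 'a) \<Rightarrow> bool" where
  "self_adjoint T \<longleftrightarrow> bounded_clinear T \<and> (\<forall>x y. cinner (T x) y = cinner x (T y))"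

definition real_spectrum :: "('a::complex_inner \<Rightarrow> 'a) \<Rightarrow> real set" where
  "real_spectrum T = {t. complex_of_real t \<in> spectrum T}"

lemma self_adjoint_bounded: "self_adjoint T \<Longrightarrow> bounded_clinear T"
  by (simp add: self_adjoint_def)

lemma self_adjoint_cinner: "self_adjoint T \<Longrightarrow> cinner (T x) y = cinner x (T y)"
  by (simp add: self_adjoint_def)

lemma self_adjoint_Im: "self_adjoint T \<Longrightarrow> Im (cinner (T x) x) = 0"
  using cinner_commute[of "T x" x] by (simp add: self_adjoint_cinner complex_eq_iff)

lemma notin_spectrum_bounded_below:
  assumes "z \<notin> spectrum T"
  shows "\<exists>c>0. \<forall>x. c * norm x \<le> norm (T x - z *\<^sub>C x)"
proof -
  from assms obtain S where S: "bounded_clinear S" and ST: "\<And>x. S (T x - z *\<^sub>C x) = x"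
    unfolding spectrum_def mem_Collect_eq not_not by blast
  \<comment> \<open>The \<open>+ 1\<close> keeps the divisor positive when
    \<open>onorm S = 0\<close>, as on the zero space.\<close>
  define k where "k = onorm S + 1"
  have k: "k > 0" "onorm S \<le> k" using bounded_clinear_onorm_pos[OF S] by (auto simp: k_def)
  have "norm x \<le> k * norm (T x - z *\<^sub>C x)" for x
  proof -
    have "norm x \<le> onorm S * norm (T x - z *\<^sub>C x)"
      using bounded_clinear_norm[OF S, of "T x - z *\<^sub>C x"] by (simp only: ST)
    also have "\<dots> \<le> k * norm (T x - z *\<^sub>C x)" by (rule mult_right_mono[OF k(2)]) simp
    finally show ?thesis .
  qed
  then have "1 / k * norm x \<le> norm (T x - z *\<^sub>C x)" for x
    using k(1) by (simp add: pos_divide_le_eq mult.commute)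
  then show ?thesis using k(1) by (intro exI[of _ "1 / k"] conjI allI) simp_all
qed

text \<open>Coercivity of \<open>a (T - t)\<close> gives it an inverse by Lax--Milgram; precomposing
  that with multiplication by \<open>a\<close> inverts \<open>T - t\<close>. The sign of
  \<open>a\<close> lets \<open>t\<close> lie on either side of the numerical range.\<close>

lemma coercive_notin_real_spectrum:
  fixes T :: "'a::complex_hilbert_space \<Rightarrow> 'a"
  assumes T: "bounded_clinear T" and "c > 0" and "a \<noteq> 0"
    and c: "\<And>x. c * (norm x)\<^sup>2 \<le> a * (Re (cinner (T x) x) - t * (norm x)\<^sup>2)"
  shows "t \<notin> real_spectrum T"
proof -
  define L where "L x = complex_of_real a *\<^sub>C (T x - complex_of_real t *\<^sub>C x)" for x
  have L: "bounded_clinear L"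
    unfolding L_def by (intro bounded_clinear_intros T)
  have "c * (norm x)\<^sup>2 \<le> Re (cinner (L x) x)" for x
    using c[of x] by (simp add: L_def cinner_algebra norm_sq_Re)
  from coercive_inverse[OF L \<open>c > 0\<close> this]
  obtain S where S: "bounded_clinear S" "\<And>x. S (L x) = x" "\<And>x. L (S x) = x" by metis
  let ?S = "\<lambda>x. S (complex_of_real a *\<^sub>C x)"
  have "bounded_clinear ?S"
    by (rule bounded_clinear_comp[OF S(1)]) (intro bounded_clinear_intros)
  moreover have "?S (T x - complex_of_real t *\<^sub>C x) = x" for x
    using S(2)[of x] by (simp add: L_def)
  moreover have "T (?S x) - complex_of_real t *\<^sub>C ?S x = x" for x
  proof -
    have "complex_of_real a *\<^sub>C (T (?S x) - complex_of_real t *\<^sub>C ?S x) = complex_of_real a *\<^sub>C x"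
      using S(3)[of "complex_of_real a *\<^sub>C x"] by (simp add: L_def)
    then show ?thesis using \<open>a \<noteq> 0\<close> by (simp flip: scaleR_scaleC)
  qed
  ultimately show ?thesis
    unfolding real_spectrum_def spectrum_def mem_Collect_eq not_not by blast
qed

lemma abs_Re_cinner_le_onorm:
  assumes "bounded_clinear T"
  shows "\<bar>Re (cinner (T x) x)\<bar> \<le> onorm T * (norm x)\<^sup>2"
proof -
  have "\<bar>Re (cinner (T x) x)\<bar> \<le> norm (T x) * norm x"
    using abs_Re_le_cmod cinner_Cauchy_Schwarz by (rule order_trans)
  also have "\<dots> \<le> onorm T * norm x * norm x"
    by (intro mult_right_mono bounded_clinear_norm assms) auto
  finally show ?thesis by (simp add: power2_eq_square mult.assoc)
qed

text \<open>The quadratic form of \<open>T\<close> stays within \<open>onorm T\<close> in absolute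
  value, so for \<open>t\<close> outside the interval either \<open>t - T\<close> or
  \<open>T - t\<close> is coercive.\<close>

lemma real_spectrum_bounded:
  fixes T :: "'a::complex_hilbert_space \<Rightarrow> 'a"
  assumes T: "bounded_clinear T"
  shows "real_spectrum T \<subseteq> {- onorm T..onorm T}"
proof
  fix t assume t: "t \<in> real_spectrum T"
  have b: "\<bar>Re (cinner (T x) x)\<bar> \<le> onorm T * (norm x)\<^sup>2" for x
    by (rule abs_Re_cinner_le_onorm[OF T])
  have "\<not> t > onorm T"
  proof
    assume gt: "t > onorm T"
    have "(t - onorm T) * (norm x)\<^sup>2 \<le> - 1 * (Re (cinner (T x) x) - t * (norm x)\<^sup>2)" for x
      using b[of x] by (simp add: left_diff_distrib abs_le_iff)
    then have "t \<notin> real_spectrum T"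
      using gt by (intro coercive_notin_real_spectrum[OF T, of "t - onorm T" "- 1"]) simp_all
    then show False using t by blast
  qed
  moreover have "\<not> t < - onorm T"
  proof
    assume lt: "t < - onorm T"
    have "(- t - onorm T) * (norm x)\<^sup>2 \<le> 1 * (Re (cinner (T x) x) - t * (norm x)\<^sup>2)" for x
      using b[of x] by (simp add: left_diff_distrib abs_le_iff)
    then have "t \<notin> real_spectrum T"
      using lt by (intro coercive_notin_real_spectrum[OF T, of "- t - onorm T" 1]) simp_all
    then show False using t by blast
  qed
  ultimately show "t \<in> {- onorm T..onorm T}" by auto
qed

lemma real_spectrum_nonneg:
  fixes T :: "'a::complex_hilbert_space \<Rightarrow> 'a"
  assumes T: "bounded_clinear T" and pos: "\<And>x. 0 \<le> Re (cinner (T x) x)"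
  shows "real_spectrum T \<subseteq> {0..onorm T}"
proof -
  have "\<not> t < 0" if t: "t \<in> real_spectrum T" for t
    using coercive_notin_real_spectrum[OF T, of "- t" 1 t] pos t by auto
  then show ?thesis using real_spectrum_bounded[OF T] by fastforce
qed

section \<open>Algebra of real polynomials in an operator\<close>

lemma poly_op_sum_le:
  "degree p \<le> n \<Longrightarrow> poly_op p T x = (\<Sum>i\<le>n. coeff p i *\<^sub>R (T ^^ i) x)"
  unfolding poly_op_def by (intro sum.mono_neutral_left) (auto simp: coeff_eq_0)

lemma poly_op_0 [simp]: "poly_op 0 T x = 0"
  by (simp add: poly_op_def)

lemma poly_op_pCons [simp]:
  assumes "linear T"
  shows "poly_op (pCons a p) T x = a *\<^sub>R x + T (poly_op p T x)"
proof -
  \<comment> \<open>\<open>Suc (degree p)\<close> is only an upper bound for the degree: for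
    \<open>p = 0\<close> the degree of \<open>pCons a p\<close> is 0.\<close>
  have "poly_op (pCons a p) T x = (\<Sum>i\<le>Suc (degree p). coeff (pCons a p) i *\<^sub>R (T ^^ i) x)"
    by (rule poly_op_sum_le) (simp add: degree_pCons_le)
  also have "\<dots> = a *\<^sub>R x + (\<Sum>i\<le>degree p. coeff p i *\<^sub>R T ((T ^^ i) x))"
    by (simp add: sum.atMost_Suc_shift del: sum.atMost_Suc)
  finally show ?thesis
    by (simp add: poly_op_def linear_sum[OF assms] linear_scale[OF assms])
qed

lemma poly_op_add: "linear T \<Longrightarrow> poly_op (p + q) T x = poly_op p T x + poly_op q T x"
  by (induction p q rule: poly_induct2) (simp_all add: linear_add[where f = T] scaleR_add_left)

lemma poly_op_smult: "linear T \<Longrightarrow> poly_op (smult a p) T x = a *\<^sub>R poly_op p T x"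
  by (induction p) (simp_all add: linear_scale[where f = T] linear_0[where f = T] scaleR_add_right)

lemma poly_op_diff: "linear T \<Longrightarrow> poly_op (p - q) T x = poly_op p T x - poly_op q T x"
  using poly_op_add[of T "p - q" q x] by simp

lemma poly_op_mult: "linear T \<Longrightarrow> poly_op (p * q) T x = poly_op p T (poly_op q T x)"
  by (induction p) (simp_all add: poly_op_add poly_op_smult)

lemma poly_op_commute: "linear T \<Longrightarrow> poly_op p T (T x) = T (poly_op p T x)"
  by (induction p) (simp_all add: linear_add[where f = T] linear_scale[where f = T] linear_0[where f = T])

lemma poly_op_monom: "poly_op (monom a n) T x = a *\<^sub>R (T ^^ n) x"
proof -
  have "poly_op (monom a n) T x = (\<Sum>i\<le>n. coeff (monom a n) i *\<^sub>R (T ^^ i) x)"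
    by (rule poly_op_sum_le) (rule degree_monom_le)
  also have "\<dots> = (\<Sum>i\<le>n. if i = n then a *\<^sub>R (T ^^ i) x else 0)"
    by (rule sum.cong) auto
  finally show ?thesis by simp
qed

lemma bounded_clinear_lin: "bounded_clinear T \<Longrightarrow> linear T"
  by (simp add: bounded_clinear_def bounded_linear.linear)

lemma bounded_clinear_poly_op:
  assumes T: "bounded_clinear T"
  shows "bounded_clinear (poly_op p T)"
proof (induction p)
  case 0
  then show ?case using bounded_clinear_zero_fun by (simp add: poly_op_def)
next
  case (pCons a p)
  have "poly_op (pCons a p) T = (\<lambda>x. complex_of_real a *\<^sub>C x + T (poly_op p T x))"
    by (simp add: fun_eq_iff bounded_clinear_lin[OF T] scaleR_scaleC)
  then show ?case by (simp, intro bounded_clinear_intros bounded_clinear_comp[OF T] pCons)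
qed

lemma self_adjoint_poly_op:
  assumes T: "self_adjoint T"
  shows "self_adjoint (poly_op p T)"
proof -
  have lin: "linear T" using T by (simp add: self_adjoint_bounded bounded_clinear_lin)
  have "cinner (poly_op p T x) y = cinner x (poly_op p T y)" for x y
    by (induction p arbitrary: x y)
      (simp_all add: lin cinner_algebra self_adjoint_cinner[OF T] poly_op_commute)
  then show ?thesis
    by (simp add: self_adjoint_def bounded_clinear_poly_op self_adjoint_bounded[OF T])
qed

section \<open>Complex polynomials, which split into linear factors, and bounds from below\<close>

definition cpoly_op :: "complex poly \<Rightarrow> ('a::complex_inner \<Rightarrow> 'a) \<Rightarrow> 'a \<Rightarrow> 'a" where
  "cpoly_op p T = (\<lambda>x. \<Sum>i\<le>degree p. coeff p i *\<^sub>C (T ^^ i) x)"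

lemma cpoly_op_0 [simp]: "cpoly_op 0 T x = 0"
  by (simp add: cpoly_op_def)

lemma cpoly_op_pCons [simp]:
  assumes T: "bounded_clinear T"
  shows "cpoly_op (pCons a p) T x = a *\<^sub>C x + T (cpoly_op p T x)"
proof -
  have "cpoly_op (pCons a p) T x = (\<Sum>i\<le>Suc (degree p). coeff (pCons a p) i *\<^sub>C (T ^^ i) x)"
    unfolding cpoly_op_def
    by (intro sum.mono_neutral_left) (auto simp: coeff_eq_0 degree_pCons_le)
  also have "\<dots> = a *\<^sub>C x + (\<Sum>i\<le>degree p. coeff p i *\<^sub>C T ((T ^^ i) x))"
    by (simp add: sum.atMost_Suc_shift del: sum.atMost_Suc)
  finally show ?thesis
    by (simp add: cpoly_op_def linear_sum[OF bounded_clinear_lin[OF T]] bounded_clinear_scaleC[OF T])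
qed

lemma cpoly_op_add:
  "bounded_clinear T \<Longrightarrow> cpoly_op (p + q) T x = cpoly_op p T x + cpoly_op q T x"
  by (induction p q rule: poly_induct2) (simp_all add: bounded_clinear_add[where T = T] bounded_clinear_zero[where T = T] scaleC_add_left)

lemma cpoly_op_smult: "bounded_clinear T \<Longrightarrow> cpoly_op (smult a p) T x = a *\<^sub>C cpoly_op p T x"
  by (induction p) (simp_all add: bounded_clinear_scaleC[where T = T] bounded_clinear_zero[where T = T] scaleC_add_right scaleC_scaleC)

lemma cpoly_op_linear_factor:
  assumes T: "bounded_clinear T"
  shows "cpoly_op ([:- z, 1:] * p) T x = T (cpoly_op p T x) - z *\<^sub>C cpoly_op p T x"
proof -
  have "[:- z, 1:] * p = smult (- z) p + pCons 0 p" by simp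
  then show ?thesis
    using scaleC_diff_left[of 0 z "cpoly_op p T x"] T
    by (simp only: cpoly_op_add cpoly_op_smult) simp
qed

lemma cpoly_op_of_real: "cpoly_op (map_poly complex_of_real p) T x = poly_op p T x"
  by (simp add: cpoly_op_def poly_op_def degree_map_poly coeff_map_poly scaleR_scaleC)

lemma poly_map_poly_of_real:
  "poly (map_poly complex_of_real p) (complex_of_real t) = complex_of_real (poly p t)"
  by (induction p) (simp_all add: map_poly_pCons)

text \<open>Induction on the degree: the fundamental theorem of algebra splits off a linear factor,
  and the lower bounds of composed operators multiply.\<close>

lemma cpoly_op_bounded_below:
  assumes T: "bounded_clinear T" and "p \<noteq> 0"
    and "\<And>z. poly p z = 0 \<Longrightarrow> \<exists>c>0. \<forall>x. c * norm x \<le> norm (T x - z *\<^sub>C x)"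
  shows "\<exists>c>0. \<forall>x. c * norm x \<le> norm (cpoly_op p T x)"
  using assms(2,3)
proof (induction "degree p" arbitrary: p rule: less_induct)
  case less
  show ?case
  proof (cases "degree p = 0")
    case True
    then obtain a where a: "p = [:a:]" by (meson degree_eq_zeroE)
    then have "cmod a > 0" "cmod a * norm x \<le> norm (cpoly_op p T x)" for x
      using less.prems(1) by (simp_all add: T norm_scaleC bounded_clinear_zero[OF T])
    then show ?thesis by blast
  next
    case False
    then obtain z where z: "poly p z = 0"
      using fundamental_theorem_of_algebra_alt[of p] by force
    then obtain q where q: "p = [:- z, 1:] * q" by (auto simp: poly_eq_0_iff_dvd dvd_def)
    with less.prems(1) have "q \<noteq> 0" by auto
    moreover have "degree q < degree p"
      using \<open>q \<noteq> 0\<close> unfolding q by (subst degree_mult_eq) auto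
    ultimately obtain c where c: "c > 0" "\<And>x. c * norm x \<le> norm (cpoly_op q T x)"
      using less.hyps[of q] less.prems(2) q by (metis mult_zero_right poly_mult)
    obtain d where d: "d > 0" "\<And>x. d * norm x \<le> norm (T x - z *\<^sub>C x)"
      using less.prems(2)[OF z] by blast
    have "d * c * norm x \<le> norm (cpoly_op p T x)" for x
    proof -
      have "d * (c * norm x) \<le> d * norm (cpoly_op q T x)" using c d by (simp add: mult_left_mono)
      also have "\<dots> \<le> norm (cpoly_op p T x)"
        unfolding q cpoly_op_linear_factor[OF T] by (rule d)
      finally show ?thesis by (simp add: mult.assoc)
    qed
    then show ?thesis using c d by (meson mult_pos_pos)
  qed
qed

text \<open>Since \<open>cinner (T x) x\<close> is real, only \<open>z\<close> contributes to the
  imaginary part of \<open>cinner (T x - z *\<^sub>C x) x\<close>; Cauchy--Schwarz does the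
  rest.\<close>

lemma self_adjoint_bounded_below_nonreal:
  assumes T: "self_adjoint T"
  shows "\<bar>Im z\<bar> * norm x \<le> norm (T x - z *\<^sub>C x)"
proof (cases "x = 0")
  case False
  have "Im (cinner (T x - z *\<^sub>C x) x) = - Im z * (norm x)\<^sup>2"
    by (simp add: cinner_algebra self_adjoint_Im[OF T] cinner_self del: of_real_power)
  then have "\<bar>Im z\<bar> * (norm x)\<^sup>2 = \<bar>Im (cinner (T x - z *\<^sub>C x) x)\<bar>"
    by (simp add: abs_mult)
  also have "\<dots> \<le> norm (T x - z *\<^sub>C x) * norm x"
    using abs_Im_le_cmod cinner_Cauchy_Schwarz by (rule order_trans)
  finally show ?thesis using False by (simp add: power2_eq_square flip: mult.assoc)
qed simp

text \<open>Each complex root of \<open>p\<close> yields a linear factor that is bounded below: a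
  real root lies outside the spectrum, and a nonreal one is covered by self-adjointness.\<close>

lemma self_adjoint_poly_op_bounded_below:
  assumes T: "self_adjoint T" and "p \<noteq> 0"
    and p: "\<And>t. t \<in> real_spectrum T \<Longrightarrow> poly p t \<noteq> 0"
  shows "\<exists>c>0. \<forall>x. c * norm x \<le> norm (poly_op p T x)"
proof -
  have "\<exists>c>0. \<forall>x. c * norm x \<le> norm (T x - z *\<^sub>C x)"
    if z: "poly (map_poly complex_of_real p) z = 0" for z
  proof (cases "Im z = 0")
    case True
    then obtain t where t: "z = complex_of_real t" by (metis complex_is_Real_iff Reals_cases)
    then have "poly p t = 0" using z by (simp add: poly_map_poly_of_real)
    then have "z \<notin> spectrum T" using p t by (auto simp: real_spectrum_def)
    then show ?thesis by (rule notin_spectrum_bounded_below)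
  next
    case False
    then show ?thesis
      using self_adjoint_bounded_below_nonreal[OF T, of z] by (intro exI[of _ "\<bar>Im z\<bar>"]) auto
  qed
  then have "\<exists>c>0. \<forall>x. c * norm x \<le> norm (cpoly_op (map_poly complex_of_real p) T x)"
    using \<open>p \<noteq> 0\<close> by (intro cpoly_op_bounded_below self_adjoint_bounded T)
      (auto simp: map_poly_eq_0_iff)
  then show ?thesis by (simp add: cpoly_op_of_real)
qed

section \<open>Spectral bounds for the norm and the quadratic form\<close>

lemma self_adjoint_norm_attained:
  assumes S: "self_adjoint S" and N: "onorm S > 0" and "c > 0"
    and c: "\<And>x. c * norm x \<le> norm (S (S x) - (onorm S)\<^sup>2 *\<^sub>R x)"
  shows False
proof -
  define N where "N = onorm S"
  note bS = self_adjoint_bounded[OF S]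
  have N0: "N > 0" using N by (simp add: N_def)
  \<comment> \<open>This will bound \<open>S\<close> although \<open>m < onorm S\<close>, a
    contradiction. The maximum with 0 is there because the sign of the difference is not known
    yet.\<close>
  define m where "m = sqrt (max 0 (N\<^sup>2 - c\<^sup>2 / N\<^sup>2))"
  have "N\<^sup>2 - c\<^sup>2 / N\<^sup>2 < N\<^sup>2" using N0 \<open>c > 0\<close> by simp
  then have "m < sqrt (N\<^sup>2)" unfolding m_def using N0 by (intro real_sqrt_less_mono) simp
  then have mN: "m < N" using N0 by simp
  have "norm (S x) \<le> m * norm x" for x
  proof (rule power2_le_imp_le)
    have "(norm (S (S x)))\<^sup>2 \<le> (N * norm (S x))\<^sup>2"
      unfolding N_def by (intro power_mono bounded_clinear_norm bS) auto
    then have 1: "(norm (S (S x)))\<^sup>2 \<le> N\<^sup>2 * (norm (S x))\<^sup>2" by (simp add: power_mult_distrib)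
    \<comment> \<open>By self-adjointness the mixed term of the square is
      \<open>(norm (S x))^2\<close>, so the lower bound \<open>c\<close> measures how far
      \<open>norm (S x)\<close> stays below \<open>N * norm x\<close>.\<close>
    have "(c * norm x)\<^sup>2 \<le> (norm (S (S x) - N\<^sup>2 *\<^sub>R x))\<^sup>2"
      using c[of x] \<open>c > 0\<close> by (intro power_mono) (auto simp: N_def)
    also have "\<dots> = (norm (S (S x)))\<^sup>2 + N\<^sup>2 * N\<^sup>2 * (norm x)\<^sup>2 - 2 * (N\<^sup>2 * (norm (S x))\<^sup>2)"
      using self_adjoint_cinner[OF S, of "S x" x]
      by (simp add: norm_diff_sq cinner_algebra norm_sq_Re[of "S x"] power_mult_distrib
          power2_eq_square[of "N\<^sup>2"])
    finally have "c\<^sup>2 * (norm x)\<^sup>2 \<le> N\<^sup>2 * (N\<^sup>2 * (norm x)\<^sup>2 - (norm (S x))\<^sup>2)"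
      using 1 by (simp add: power_mult_distrib algebra_simps)
    then have "(norm (S x))\<^sup>2 \<le> (N\<^sup>2 - c\<^sup>2 / N\<^sup>2) * (norm x)\<^sup>2"
      using N0 by (simp add: field_simps)
    also have "\<dots> \<le> max 0 (N\<^sup>2 - c\<^sup>2 / N\<^sup>2) * (norm x)\<^sup>2"
      by (intro mult_right_mono) auto
    finally show "(norm (S x))\<^sup>2 \<le> (m * norm x)\<^sup>2" by (simp add: m_def power_mult_distrib)
  qed (simp add: m_def)
  then have "onorm S \<le> m" by (intro onorm_bound) (auto simp: m_def)
  then show False using mN by (simp add: N_def)
qed

text \<open>Without spectral points every nonzero polynomial in \<open>T\<close> is bounded below.
  For \<open>t^2 - N^2\<close> with \<open>N = onorm T\<close> this forces \<open>N = 0\<close>, so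
  \<open>T = 0\<close>; for the polynomial \<open>t\<close> it then forces every vector to
  vanish.\<close>

lemma real_spectrum_empty:
  fixes T :: "'a::complex_inner \<Rightarrow> 'a"
  assumes T: "self_adjoint T" and "real_spectrum T = {}"
  shows "(x::'a) = 0"
proof -
  note bT = self_adjoint_bounded[OF T]
  note lin = bounded_clinear_lin[OF bT]
  have below: "\<exists>c>0. \<forall>x. c * norm x \<le> norm (poly_op p T x)" if "p \<noteq> 0" for p
    using self_adjoint_poly_op_bounded_below[OF T that] assms(2) by simp
  define N where "N = onorm T"
  have "poly_op [:- (N\<^sup>2), 0, 1:] T x = T (T x) - N\<^sup>2 *\<^sub>R x" for x
    by (simp add: lin linear_0)
  then have "\<exists>c>0. \<forall>x. c * norm x \<le> norm (T (T x) - N\<^sup>2 *\<^sub>R x)"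
    using below[of "[:- (N\<^sup>2), 0, 1:]"] by simp
  then have "\<not> N > 0"
    using self_adjoint_norm_attained[OF T] unfolding N_def by blast
  then have "T x = 0" for x
    using bounded_clinear_norm[OF bT, of x] bounded_clinear_onorm_pos[OF bT] by (simp add: N_def)
  then have "poly_op [:0, 1:] T x = 0" by (simp add: lin)
  moreover obtain c where "c > 0" "\<And>x. c * norm x \<le> norm (poly_op [:0, 1:] T x)"
    using below[of "[:0, 1:]"] by auto
  ultimately show "x = 0" by (metis mult_le_0_iff norm_le_zero_iff norm_zero not_less)
qed

text \<open>Only the approximate point spectrum enters: \<open>p(T)\<^sup>2 - N\<^sup>2\<close> with \<open>N = \<parallel>p(T)\<parallel>\<close> is not bounded below,
  hence one of its linear factors over the complex numbers is not, and the corresponding root is a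
  point \<open>t\<close> of the real spectrum with \<open>\<bar>p(t)\<bar> = N\<close>.\<close>

lemma onorm_poly_op_le:
  fixes T :: "'a::complex_inner \<Rightarrow> 'a"
  assumes T: "self_adjoint T" and "M \<ge> 0"
    and M: "\<And>t. t \<in> real_spectrum T \<Longrightarrow> \<bar>poly p t\<bar> \<le> M"
  shows "onorm (poly_op p T) \<le> M"
proof (rule ccontr)
  define N where "N = onorm (poly_op p T)"
  have lin: "linear T" using T by (simp add: self_adjoint_bounded bounded_clinear_lin)
  assume "\<not> ?thesis"
  then have NM: "N > M" by (simp add: N_def)
  define q where "q = p * p - [:N\<^sup>2:]"
  have q: "poly_op q T x = poly_op p T (poly_op p T x) - N\<^sup>2 *\<^sub>R x" for x
    by (simp add: q_def poly_op_diff poly_op_mult lin linear_0)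
  have "(poly p t)\<^sup>2 < N\<^sup>2" if "t \<in> real_spectrum T" for t
    using M[OF that] NM \<open>M \<ge> 0\<close> by (metis abs_ge_zero order_le_less_trans power2_abs power_strict_mono zero_less_numeral)
  then have roots: "poly q t \<noteq> 0" if "t \<in> real_spectrum T" for t
    using that by (fastforce simp: q_def power2_eq_square)
  have "\<exists>c>0. \<forall>x. c * norm x \<le> norm (poly_op q T x)"
  proof (cases "q = 0")
    \<comment> \<open>Every spectral point would be a root of \<open>q\<close>, so the spectrum is
      empty and the space is zero, where any lower bound holds.\<close>
    case True
    then have "real_spectrum T = {}" using roots by auto
    then have "norm (poly_op q T x) = norm x" for x
      using real_spectrum_empty[OF T, of "poly_op q T x"] real_spectrum_empty[OF T, of x] by simp
    then show ?thesis by (intro exI[of _ 1]) auto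
  next
    case False
    then show ?thesis using self_adjoint_poly_op_bounded_below[OF T] roots by blast
  qed
  then show False
    using self_adjoint_norm_attained[OF self_adjoint_poly_op[OF T, of p]] NM \<open>M \<ge> 0\<close>
    unfolding q N_def by fastforce
qed

text \<open>Subtracting the midpoint of \<open>[c, M]\<close> from \<open>p\<close> leaves values of
  absolute value at most \<open>h\<close> on the spectrum; the norm bound then puts the quadratic
  form above \<open>(c + M) / 2 - h = c\<close>.\<close>

lemma poly_op_lower_bound:
  fixes T :: "'a::complex_hilbert_space \<Rightarrow> 'a"
  assumes T: "self_adjoint T" and c: "\<And>t. t \<in> real_spectrum T \<Longrightarrow> c \<le> poly p t"
  shows "c * (norm x)\<^sup>2 \<le> Re (cinner (poly_op p T x) x)"
proof -
  note bT = self_adjoint_bounded[OF T]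
  note lin = bounded_clinear_lin[OF bT]
  have "bounded (poly p ` {- onorm T..onorm T})"
    by (intro compact_imp_bounded compact_continuous_image continuous_intros compact_Icc)
  then obtain M' where "\<forall>y\<in>poly p ` {- onorm T..onorm T}. norm y \<le> M'"
    unfolding bounded_iff by blast
  then have M': "\<bar>poly p t\<bar> \<le> M'" if "t \<in> {- onorm T..onorm T}" for t
    using that by auto
  \<comment> \<open>The maximum ensures \<open>h \<ge> 0\<close> even if the spectrum is
    empty.\<close>
  define M where "M = max M' c"
  define h where "h = (M - c) / 2"
  define q where "q = p - [:(c + M) / 2:]"
  have "\<bar>poly q t\<bar> \<le> h" if "t \<in> real_spectrum T" for t
  proof -
    have "poly p t \<le> M"
      using M'[of t] that real_spectrum_bounded[OF bT] by (force simp: M_def)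
    then show ?thesis using c[OF that] by (simp add: q_def h_def abs_le_iff field_simps)
  qed
  then have "onorm (poly_op q T) \<le> h"
    by (intro onorm_poly_op_le T) (simp_all add: h_def M_def)
  then have "onorm (poly_op q T) * (norm x)\<^sup>2 \<le> h * (norm x)\<^sup>2" by (rule mult_right_mono) simp
  then have "- (h * (norm x)\<^sup>2) \<le> Re (cinner (poly_op q T x) x)"
    using abs_Re_cinner_le_onorm[OF bounded_clinear_poly_op[OF bT], of q x] by linarith
  also have "\<dots> = Re (cinner (poly_op p T x) x) - (c + M) / 2 * (norm x)\<^sup>2"
    by (simp add: q_def poly_op_diff[OF lin] lin linear_0[OF lin] cinner_algebra norm_sq_Re)
  finally show ?thesis by (simp add: h_def algebra_simps add_divide_distrib diff_divide_distrib)
qed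

section \<open>Continuous functional calculus\<close>

lemma uniform_poly_approximation:
  fixes f :: "real \<Rightarrow> real"
  assumes "continuous_on {a..b} f"
  obtains p :: "nat \<Rightarrow> real poly" where "uniform_limit {a..b} (\<lambda>n. poly (p n)) f sequentially"
proof -
  have "\<exists>p. \<forall>t\<in>{a..b}. \<bar>f t - poly p t\<bar> < 1 / real (Suc n)" for n
  proof -
    obtain g where g: "real_polynomial_function g"
      "\<And>t. t \<in> {a..b} \<Longrightarrow> \<bar>f t - g t\<bar> < 1 / real (Suc n)"
      using Stone_Weierstrass_real_polynomial_function[OF compact_Icc assms, of "1 / real (Suc n)"]
      by auto
    then obtain c m where "g = (\<lambda>t. \<Sum>i\<le>m. c i * t ^ i)"
      by (auto simp: real_polynomial_function_iff_sum)
    then have "g = poly (\<Sum>i\<le>m. monom (c i) i)"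
      by (simp add: fun_eq_iff poly_sum poly_monom)
    then show ?thesis using g(2) by blast
  qed
  then obtain p where p: "\<And>n t. t \<in> {a..b} \<Longrightarrow> \<bar>f t - poly (p n) t\<bar> < 1 / real (Suc n)"
    by metis
  have "uniform_limit {a..b} (\<lambda>n. poly (p n)) f sequentially"
  proof (rule uniform_limitI)
    fix e :: real assume "e > 0"
    have "\<forall>\<^sub>F n in sequentially. 1 / real (Suc n) < e"
      using order_tendstoD(2)[OF LIMSEQ_inverse_real_of_nat \<open>e > 0\<close>] by (simp add: inverse_eq_divide)
    then show "\<forall>\<^sub>F n in sequentially. \<forall>t\<in>{a..b}. dist (poly (p n) t) (f t) < e"
    proof (rule eventually_mono)
      fix n assume n: "1 / real (Suc n) < e"
      show "\<forall>t\<in>{a..b}. dist (poly (p n) t) (f t) < e"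
        unfolding dist_real_def using less_trans[OF p n] by (subst abs_minus_commute) blast
    qed
  qed
  then show ?thesis by (rule that)
qed

lemma tendsto_pointwise_of_onorm:
  assumes "\<And>n. bounded_linear (F n)" "bounded_linear S"
    and "(\<lambda>n. onorm (\<lambda>x. F n x - S x)) \<longlonglongrightarrow> 0"
  shows "(\<lambda>n. F n x) \<longlonglongrightarrow> S x"
proof -
  have "(\<lambda>n. onorm (\<lambda>x. F n x - S x) * norm x) \<longlonglongrightarrow> 0"
    using tendsto_mult_right[OF assms(3), of "norm x"] by simp
  then have "(\<lambda>n. norm (F n x - S x)) \<longlonglongrightarrow> 0"
    by (rule tendsto_sandwich[OF _ _ tendsto_const, rotated 2])
      (auto intro!: always_eventually onorm[of "\<lambda>x. F n x - S x" for n] bounded_linear_sub assms)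
  then show ?thesis by (simp add: tendsto_norm_zero_iff LIM_zero_iff)
qed

lemma tendsto_cinner:
  fixes X Y :: "nat \<Rightarrow> 'a::complex_inner"
  assumes "X \<longlonglongrightarrow> x" "Y \<longlonglongrightarrow> y"
  shows "(\<lambda>n. cinner (X n) (Y n)) \<longlonglongrightarrow> cinner x y"
proof -
  have "bounded_bilinear (cinner :: 'a \<Rightarrow> 'a \<Rightarrow> complex)"
    by (rule bounded_bilinear.intro)
      (auto simp: cinner_algebra scaleR_conv_of_real cinner_Cauchy_Schwarz intro!: exI[of _ 1])
  then show ?thesis using assms by (rule bounded_bilinear.tendsto)
qed

text \<open>Continuity is asked on an interval around the spectrum, so that Weierstrass
  approximation applies there and restricts to the spectrum.\<close>

locale continuous_calculus =
  fixes T :: "'a::complex_hilbert_space \<Rightarrow> 'a" and f :: "real \<Rightarrow> real" and a b :: real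
  assumes self_adjoint: "self_adjoint T"
    and spectrum: "real_spectrum T \<subseteq> {a..b}"
    and continuous: "continuous_on {a..b} f"
begin

abbreviation approximates :: "(nat \<Rightarrow> real poly) \<Rightarrow> bool" where
  "approximates p \<equiv> uniform_limit (real_spectrum T) (\<lambda>n. poly (p n)) f sequentially"

lemma bounded: "bounded_clinear T"
  by (rule self_adjoint_bounded[OF self_adjoint])

lemma lin: "linear T"
  by (rule bounded_clinear_lin[OF bounded])

lemma poly_op_bounded: "bounded_linear (poly_op p T)"
  by (rule bounded_clinear_linear[OF bounded_clinear_poly_op[OF bounded]])

lemma ex_approximates: "\<exists>p. approximates p"
  using uniform_poly_approximation[OF continuous] uniform_limit_on_subset[OF _ spectrum] by metis

lemma onorm_poly_op_diff_le:
  assumes "e \<ge> 0" "\<And>t. t \<in> real_spectrum T \<Longrightarrow> \<bar>poly p t - poly q t\<bar> \<le> e"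
  shows "onorm (\<lambda>x. poly_op p T x - poly_op q T x) \<le> e"
proof -
  have "(\<lambda>x. poly_op p T x - poly_op q T x) = poly_op (p - q) T"
    by (simp add: fun_eq_iff poly_op_diff[OF lin])
  then show ?thesis using onorm_poly_op_le[OF self_adjoint assms(1), of "p - q"] assms(2) by simp
qed

text \<open>Stated for two sequences: \<open>p = q\<close> gives the Cauchy property, and different
  sequences give independence of the limit from the choice.\<close>

lemma approximates_close:
  assumes p: "approximates p" and q: "approximates q" and "e > 0"
  obtains N where "\<And>m n. m \<ge> N \<Longrightarrow> n \<ge> N \<Longrightarrow> onorm (\<lambda>x. poly_op (p m) T x - poly_op (q n) T x) \<le> e"
proof -
  have "e / 2 > 0" using \<open>e > 0\<close> by simp
  obtain N1 where N1: "\<And>n t. n \<ge> N1 \<Longrightarrow> t \<in> real_spectrum T \<Longrightarrow> \<bar>poly (p n) t - f t\<bar> < e / 2"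
    using uniform_limitD[OF p \<open>e / 2 > 0\<close>] by (auto simp: eventually_sequentially dist_real_def)
  obtain N2 where N2: "\<And>n t. n \<ge> N2 \<Longrightarrow> t \<in> real_spectrum T \<Longrightarrow> \<bar>poly (q n) t - f t\<bar> < e / 2"
    using uniform_limitD[OF q \<open>e / 2 > 0\<close>] by (auto simp: eventually_sequentially dist_real_def)
  have "onorm (\<lambda>x. poly_op (p m) T x - poly_op (q n) T x) \<le> e"
    if "m \<ge> max N1 N2" "n \<ge> max N1 N2" for m n
  proof (rule onorm_poly_op_diff_le)
    fix t assume "t \<in> real_spectrum T"
    then have "\<bar>poly (p m) t - f t\<bar> < e / 2" "\<bar>poly (q n) t - f t\<bar> < e / 2"
      using N1 N2 that by auto
    then show "\<bar>poly (p m) t - poly (q n) t\<bar> \<le> e" by linarith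
  qed (use \<open>e > 0\<close> in simp)
  then show ?thesis by (rule that)
qed

lemma ex_limit:
  "\<exists>S. bounded_clinear S \<and>
    (\<forall>p. approximates p \<longrightarrow> (\<lambda>n. onorm (\<lambda>x. poly_op (p n) T x - S x)) \<longlonglongrightarrow> 0)"
proof -
  obtain p where p: "approximates p" using ex_approximates by blast
  \<comment> \<open>As elements of the Banach space of bounded real-linear maps, the operators
    converge once they form a Cauchy sequence.\<close>
  define B where "B n = Blinfun (poly_op (p n) T)" for n
  have B: "blinfun_apply (B n) = poly_op (p n) T" for n
    unfolding B_def by (rule bounded_linear_Blinfun_apply[OF poly_op_bounded])
  have nB: "norm (B m - B n) = onorm (\<lambda>x. poly_op (p m) T x - poly_op (p n) T x)" for m n
    by (simp add: norm_blinfun.rep_eq minus_blinfun.rep_eq B)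
  have "Cauchy B"
  proof (rule CauchyI)
    fix e :: real assume "e > 0"
    then obtain N where N: "\<And>m n. m \<ge> N \<Longrightarrow> n \<ge> N \<Longrightarrow> norm (B m - B n) \<le> e / 2"
      using approximates_close[OF p p, of "e / 2"] unfolding nB by auto
    have "norm (B m - B n) < e" if "m \<ge> N" "n \<ge> N" for m n
      using N[OF that] \<open>e > 0\<close> by linarith
    then show "\<exists>M. \<forall>m\<ge>M. \<forall>n\<ge>M. norm (B m - B n) < e" by blast
  qed
  then obtain L where L: "B \<longlonglongrightarrow> L" by (auto simp: Cauchy_convergent_iff convergent_def)
  define S where "S = blinfun_apply L"
  have bS: "bounded_linear S" by (simp add: S_def blinfun.bounded_linear_right)
  have "(\<lambda>n. norm (B n - L)) \<longlonglongrightarrow> 0"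
    using L by (simp add: tendsto_norm_zero_iff LIM_zero_iff)
  then have S: "(\<lambda>n. onorm (\<lambda>x. poly_op (p n) T x - S x)) \<longlonglongrightarrow> 0"
    by (simp add: norm_blinfun.rep_eq minus_blinfun.rep_eq B S_def)
  note point = tendsto_pointwise_of_onorm[OF poly_op_bounded bS S]
  \<comment> \<open>The limit in that space is only known to be real-linear; complex homogeneity
    passes to it pointwise.\<close>
  have "S (c *\<^sub>C x) = c *\<^sub>C S x" for c x
  proof (rule LIMSEQ_unique[OF point])
    have "bounded_clinear (\<lambda>x::'a. c *\<^sub>C x)" by (intro bounded_clinear_intros)
    then have "(\<lambda>n. c *\<^sub>C poly_op (p n) T x) \<longlonglongrightarrow> c *\<^sub>C S x"
      by (rule bounded_linear.tendsto[OF bounded_clinear_linear point])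
    then show "(\<lambda>n. poly_op (p n) T (c *\<^sub>C x)) \<longlonglongrightarrow> c *\<^sub>C S x"
      by (simp add: bounded_clinear_scaleC[OF bounded_clinear_poly_op[OF bounded]])
  qed
  with bS have "bounded_clinear S" by (simp add: bounded_clinear_def)
  moreover have "(\<lambda>n. onorm (\<lambda>x. poly_op (q n) T x - S x)) \<longlonglongrightarrow> 0" if q: "approximates q" for q
  proof (rule tendsto_sandwich[OF _ _ tendsto_const])
    have "(\<lambda>n. onorm (\<lambda>x. poly_op (q n) T x - poly_op (p n) T x)) \<longlonglongrightarrow> 0"
    proof (rule LIMSEQ_I)
      fix e :: real assume "e > 0"
      then obtain N where N: "\<And>m n. m \<ge> N \<Longrightarrow> n \<ge> N \<Longrightarrow>
          onorm (\<lambda>x. poly_op (q m) T x - poly_op (p n) T x) \<le> e / 2"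
        using approximates_close[OF q p, of "e / 2"] by auto
      have "norm (onorm (\<lambda>x. poly_op (q n) T x - poly_op (p n) T x) - 0) < e" if "n \<ge> N" for n
      proof -
        have "0 \<le> onorm (\<lambda>x. poly_op (q n) T x - poly_op (p n) T x)"
          by (intro onorm_pos_le bounded_linear_sub poly_op_bounded)
        then show ?thesis using N[OF that that] \<open>e > 0\<close> by simp
      qed
      then show "\<exists>N. \<forall>n\<ge>N. norm (onorm (\<lambda>x. poly_op (q n) T x - poly_op (p n) T x) - 0) < e"
        by blast
    qed
    from tendsto_add[OF this S]
    show "(\<lambda>n. onorm (\<lambda>x. poly_op (q n) T x - poly_op (p n) T x)
        + onorm (\<lambda>x. poly_op (p n) T x - S x)) \<longlonglongrightarrow> 0" by simp
    show "\<forall>\<^sub>F n in sequentially. onorm (\<lambda>x. poly_op (q n) T x - S x)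
      \<le> onorm (\<lambda>x. poly_op (q n) T x - poly_op (p n) T x) + onorm (\<lambda>x. poly_op (p n) T x - S x)"
    proof (rule always_eventually, rule allI)
      fix n
      have "bounded_linear (\<lambda>x. poly_op (q n) T x - poly_op (p n) T x)"
        "bounded_linear (\<lambda>x. poly_op (p n) T x - S x)"
        by (intro bounded_linear_sub poly_op_bounded bS)+
      from onorm_triangle[OF this]
      show "onorm (\<lambda>x. poly_op (q n) T x - S x)
        \<le> onorm (\<lambda>x. poly_op (q n) T x - poly_op (p n) T x) + onorm (\<lambda>x. poly_op (p n) T x - S x)"
        by simp
    qed
    show "\<forall>\<^sub>F n in sequentially. 0 \<le> onorm (\<lambda>x. poly_op (q n) T x - S x)"
      by (intro always_eventually allI onorm_pos_le bounded_linear_sub poly_op_bounded bS)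
  qed
  ultimately show ?thesis by blast
qed

text \<open>The description in \<open>cfc_def\<close> is well defined. Uniqueness uses that some
  approximating sequence exists, for otherwise the convergence condition would be vacuous.\<close>

lemma cfc_limit:
  shows bounded_clinear_cfc: "bounded_clinear (cfc f T)"
    and "approximates p \<Longrightarrow> (\<lambda>n. onorm (\<lambda>x. poly_op (p n) T x - cfc f T x)) \<longlonglongrightarrow> 0"
proof -
  let ?Q = "\<lambda>S. bounded_clinear S \<and>
    (\<forall>p. approximates p \<longrightarrow> (\<lambda>n. onorm (\<lambda>x. poly_op (p n) T x - S x)) \<longlonglongrightarrow> 0)"
  obtain S where S: "?Q S"
    using ex_limit by (rule exE)
  have point: "(\<lambda>n. poly_op (p n) T x) \<longlonglongrightarrow> R x" if R: "?Q R" and p: "approximates p" for R p x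
  proof (rule tendsto_pointwise_of_onorm[OF poly_op_bounded])
    show "bounded_linear R" by (rule bounded_clinear_linear[OF conjunct1[OF R]])
    show "(\<lambda>n. onorm (\<lambda>x. poly_op (p n) T x - R x)) \<longlonglongrightarrow> 0"
      by (rule conjunct2[OF R, rule_format, OF p])
  qed
  have "S' = S" if S': "?Q S'" for S'
  proof
    fix x
    obtain p where p: "approximates p" using ex_approximates by blast
    show "S' x = S x" by (rule LIMSEQ_unique[OF point[OF S' p] point[OF S p]])
  qed
  then have "(THE S. ?Q S) = S" by (rule the_equality[where P = ?Q, OF S])
  then have eq: "cfc f T = S" unfolding cfc_def real_spectrum_def .
  have Q: "?Q (cfc f T)" unfolding eq by (rule S)
  show "bounded_clinear (cfc f T)" by (rule conjunct1[OF Q])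
  show "(\<lambda>n. onorm (\<lambda>x. poly_op (p n) T x - cfc f T x)) \<longlonglongrightarrow> 0" if "approximates p"
    by (rule conjunct2[OF Q, rule_format, OF that])
qed

lemma cfc_pointwise:
  "approximates p \<Longrightarrow> (\<lambda>n. poly_op (p n) T x) \<longlonglongrightarrow> cfc f T x"
  by (rule tendsto_pointwise_of_onorm[OF poly_op_bounded bounded_clinear_linear[OF bounded_clinear_cfc]
        cfc_limit(2)])

lemma self_adjoint_cfc: "self_adjoint (cfc f T)"
proof -
  obtain p where p: "approximates p" using ex_approximates by blast
  have "cinner (cfc f T x) y = cinner x (cfc f T y)" for x y
  proof (rule LIMSEQ_unique)
    show "(\<lambda>n. cinner (poly_op (p n) T x) y) \<longlonglongrightarrow> cinner (cfc f T x) y"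
      by (intro tendsto_cinner cfc_pointwise p tendsto_const)
    have "(\<lambda>n. cinner x (poly_op (p n) T y)) \<longlonglongrightarrow> cinner x (cfc f T y)"
      by (intro tendsto_cinner cfc_pointwise p tendsto_const)
    then show "(\<lambda>n. cinner (poly_op (p n) T x) y) \<longlonglongrightarrow> cinner x (cfc f T y)"
      by (simp add: self_adjoint_cinner[OF self_adjoint_poly_op[OF self_adjoint]])
  qed
  then show ?thesis by (simp add: self_adjoint_def bounded_clinear_cfc)
qed

text \<open>For \<open>e > 0\<close> the polynomials \<open>p n - q\<close> are eventually at least
  \<open>- e\<close> on the spectrum; apply the lower bound for polynomials, then let
  \<open>n\<close> grow and \<open>e\<close> shrink. With \<open>q = 0\<close> it gives positivity,
  with a tangent it gives McCarthy's inequality.\<close>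

lemma poly_op_le_cfc:
  assumes q: "\<And>t. t \<in> real_spectrum T \<Longrightarrow> poly q t \<le> f t"
  shows "Re (cinner (poly_op q T x) x) \<le> Re (cinner (cfc f T x) x)"
proof -
  obtain p where p: "approximates p" using ex_approximates by blast
  have "(\<lambda>n. Re (cinner (poly_op (p n) T x) x)) \<longlonglongrightarrow> Re (cinner (cfc f T x) x)"
    by (intro tendsto_Re tendsto_cinner cfc_pointwise p tendsto_const)
  moreover have "Re (cinner (poly_op q T x) x) - e * (norm x)\<^sup>2 \<le> Re (cinner (cfc f T x) x)"
    if "e > 0" for e
  proof (rule tendsto_lowerbound[OF calculation])
    have "\<forall>\<^sub>F n in sequentially. \<forall>t\<in>real_spectrum T. dist (poly (p n) t) (f t) < e"
      by (rule uniform_limitD[OF p that])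
    then show "\<forall>\<^sub>F n in sequentially.
      Re (cinner (poly_op q T x) x) - e * (norm x)\<^sup>2 \<le> Re (cinner (poly_op (p n) T x) x)"
    proof (rule eventually_mono)
      fix n assume n: "\<forall>t\<in>real_spectrum T. dist (poly (p n) t) (f t) < e"
      have "- e \<le> poly (p n - q) t" if "t \<in> real_spectrum T" for t
        using n[rule_format, OF that] q[OF that] by (simp add: dist_real_def abs_less_iff)
      from poly_op_lower_bound[OF self_adjoint this]
      show "Re (cinner (poly_op q T x) x) - e * (norm x)\<^sup>2 \<le> Re (cinner (poly_op (p n) T x) x)"
        by (simp add: poly_op_diff[OF lin] cinner_algebra algebra_simps)
    qed
  qed simp
  ultimately show ?thesis
  proof -
    assume le: "\<And>e. e > 0 \<Longrightarrow>
      Re (cinner (poly_op q T x) x) - e * (norm x)\<^sup>2 \<le> Re (cinner (cfc f T x) x)"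
    show ?thesis
    proof (rule field_le_epsilon)
      fix d :: real assume "d > 0"
      define n where "n = (norm x)\<^sup>2 + 1"
      have n: "n > 0" "(norm x)\<^sup>2 \<le> n" by (auto simp: n_def add_nonneg_pos)
      have "d / n * (norm x)\<^sup>2 \<le> d / n * n"
        using n \<open>d > 0\<close> by (intro mult_left_mono) auto
      then have "d / n * (norm x)\<^sup>2 \<le> d" using n by simp
      then show "Re (cinner (poly_op q T x) x) \<le> Re (cinner (cfc f T x) x) + d"
        using le[of "d / n"] n \<open>d > 0\<close> by simp
    qed
  qed
qed

text \<open>The squares of the approximating polynomials tend uniformly to \<open>t\<close> on the
  spectrum, so their operators tend to \<open>T\<close>.\<close>

lemma cfc_square_root:
  assumes f: "\<And>t. t \<in> {a..b} \<Longrightarrow> f t * f t = t"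
  shows "cfc f T (cfc f T x) = T x"
proof -
  obtain p where p: "approximates p" using ex_approximates by blast
  have "bounded (f ` {a..b})"
    by (intro compact_imp_bounded compact_continuous_image continuous compact_Icc)
  then have bf: "bounded (f ` real_spectrum T)"
    using spectrum by (meson bounded_subset image_mono)
  have lim: "uniform_limit (real_spectrum T) (\<lambda>n t. poly (p n) t * poly (p n) t)
      (\<lambda>t. f t * f t) sequentially"
    by (rule uniform_lim_mult[OF p p bf bf])
  have X: "poly_op [:0, 1:] T x = T x" for x by (simp add: lin linear_0[OF lin])
  have "(\<lambda>n. onorm (\<lambda>x. poly_op (p n * p n) T x - T x)) \<longlonglongrightarrow> 0"
  proof (rule LIMSEQ_I)
    fix e :: real assume "e > 0"
    then have "e / 2 > 0" by simp
    from uniform_limitD[OF lim this]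
    obtain N where N: "\<And>n t. n \<ge> N \<Longrightarrow> t \<in> real_spectrum T \<Longrightarrow>
        \<bar>poly (p n) t * poly (p n) t - f t * f t\<bar> < e / 2"
      by (auto simp: eventually_sequentially dist_real_def)
    have "norm (onorm (\<lambda>x. poly_op (p n * p n) T x - T x) - 0) < e" if "n \<ge> N" for n
    proof -
      have "\<bar>poly (p n * p n) t - poly [:0, 1:] t\<bar> \<le> e / 2" if t: "t \<in> real_spectrum T" for t
        using N[OF \<open>n \<ge> N\<close> t] f[of t] t spectrum by (auto simp: less_imp_le)
      then have "onorm (\<lambda>x. poly_op (p n * p n) T x - T x) \<le> e / 2"
        using onorm_poly_op_diff_le[of "e / 2" "p n * p n" "[:0, 1:]"] \<open>e > 0\<close>
        unfolding X by simp
      moreover have "0 \<le> onorm (\<lambda>x. poly_op (p n * p n) T x - T x)"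
        by (intro onorm_pos_le bounded_linear_sub poly_op_bounded bounded_clinear_linear[OF bounded])
      ultimately show ?thesis using \<open>e > 0\<close> by simp
    qed
    then show "\<exists>N. \<forall>n\<ge>N. norm (onorm (\<lambda>x. poly_op (p n * p n) T x - T x) - 0) < e" by blast
  qed
  then have lim2: "(\<lambda>n. poly_op (p n * p n) T x) \<longlonglongrightarrow> T x" for x
    by (rule tendsto_pointwise_of_onorm[OF poly_op_bounded bounded_clinear_linear[OF bounded]])
  \<comment> \<open>Moving one factor to the other side of the inner product identifies the same
    limit with the square of \<open>cfc f T\<close>, by joint continuity of
    \<open>cinner\<close>.\<close>
  show ?thesis
  proof (rule cinner_ext, rule LIMSEQ_unique)
    fix y
    have "(\<lambda>n. cinner (poly_op (p n) T y) (poly_op (p n) T x)) \<longlonglongrightarrow> cinner (cfc f T y) (cfc f T x)"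
      by (intro tendsto_cinner cfc_pointwise p)
    then show "(\<lambda>n. cinner (poly_op (p n) T y) (poly_op (p n) T x)) \<longlonglongrightarrow> cinner y (cfc f T (cfc f T x))"
      by (simp add: self_adjoint_cinner[OF self_adjoint_cfc])
    have "(\<lambda>n. cinner y (poly_op (p n * p n) T x)) \<longlonglongrightarrow> cinner y (T x)"
      by (intro tendsto_cinner lim2 tendsto_const)
    then show "(\<lambda>n. cinner (poly_op (p n) T y) (poly_op (p n) T x)) \<longlonglongrightarrow> cinner y (T x)"
      by (simp add: poly_op_mult[OF lin] self_adjoint_cinner[OF self_adjoint_poly_op[OF self_adjoint]])
  qed
qed

end

section \<open>Scalar inequalities\<close>

text \<open>Convexity and the derivative are used on the open half-line, so zero arguments are
  treated apart. At \<open>l = 0\<close> the left side is 0, also for \<open>r = 1\<close>, because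
  \<open>0 powr 0 = 0\<close>.\<close>

lemma powr_above_tangent:
  fixes l t r :: real
  assumes "r \<ge> 1" "l \<ge> 0" "t \<ge> 0"
  shows "l powr r + r * l powr (r - 1) * (t - l) \<le> t powr r"
proof (cases "l = 0 \<or> t = 0")
  case True
  then show ?thesis
  proof
    assume "t = 0"
    have "l powr (r - 1) * l = l powr r"
      using powr_mult_base[OF \<open>l \<ge> 0\<close>, of "r - 1"] by (simp add: mult.commute)
    then have "l powr r + r * l powr (r - 1) * (t - l) = (1 - r) * l powr r"
      using \<open>t = 0\<close> by (simp add: algebra_simps)
    also have "\<dots> \<le> 0" using \<open>r \<ge> 1\<close> by (simp add: mult_le_0_iff)
    finally show ?thesis using \<open>t = 0\<close> by simp
  qed simp
next
  case False
  then have pos: "l > 0" "t > 0" using assms by auto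
  have "t powr r - l powr r \<ge> r * l powr (r - 1) * (t - l)"
  proof (rule convex_on_imp_above_tangent[OF powr_convex[OF \<open>r \<ge> 1\<close>]])
    show "((\<lambda>x. x powr r) has_real_derivative r * l powr (r - 1)) (at l within {0<..})"
      by (rule has_field_derivative_at_within[OF has_real_derivative_powr[OF pos(1)]])
  qed (use pos in \<open>simp_all add: interior_open convex_connected\<close>)
  then show ?thesis by simp
qed

text \<open>Add the tangent inequalities at the midpoint: the two linear terms cancel.\<close>

lemma powr_midpoint_le:
  fixes a b r :: real
  assumes "r \<ge> 1" "a \<ge> 0" "b \<ge> 0"
  shows "((a + b) / 2) powr r \<le> (a powr r + b powr r) / 2"
proof -
  define l where "l = (a + b) / 2"
  have "l \<ge> 0" using assms by (simp add: l_def)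
  define k where "k = r * l powr (r - 1) * (a - l)"
  have "b - l = - (a - l)" by (simp add: l_def field_simps)
  then have "r * l powr (r - 1) * (b - l) = - k" by (simp only: k_def mult_minus_right)
  then have "l powr r + k \<le> a powr r" "l powr r - k \<le> b powr r"
    using powr_above_tangent[OF \<open>r \<ge> 1\<close> \<open>l \<ge> 0\<close> \<open>a \<ge> 0\<close>]
      powr_above_tangent[OF \<open>r \<ge> 1\<close> \<open>l \<ge> 0\<close> \<open>b \<ge> 0\<close>] by (simp_all add: k_def)
  then have "(l powr r + k) + (l powr r - k) \<le> a powr r + b powr r" by (rule add_mono)
  then show ?thesis by (simp add: l_def)
qed

section \<open>Absolute values and powers of operators\<close>

lemma positive_continuous_calculus:
  fixes T :: "'a::complex_hilbert_space \<Rightarrow> 'a"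
  assumes "self_adjoint T" "\<And>x. 0 \<le> Re (cinner (T x) x)" "s > 0"
  shows "continuous_calculus T (\<lambda>t. t powr s) 0 (onorm T)"
proof
  show "real_spectrum T \<subseteq> {0..onorm T}"
    by (rule real_spectrum_nonneg[OF self_adjoint_bounded]) (use assms in auto)
  show "continuous_on {0..onorm T} (\<lambda>t. t powr s)"
    using \<open>s > 0\<close> by (intro continuous_on_powr' continuous_intros) auto
qed fact

text \<open>All that is used later about \<open>op_abs A\<close>. Positivity compares the square
  root with the zero polynomial.\<close>

lemma op_abs_properties:
  fixes A :: "'a::complex_hilbert_space \<Rightarrow> 'a"
  assumes A: "bounded_clinear A"
  shows self_adjoint_op_abs: "self_adjoint (op_abs A)"
    and op_abs_nonneg: "0 \<le> Re (cinner (op_abs A x) x)"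
    and op_abs_square: "op_abs A (op_abs A x) = cadjoint A (A x)"
proof -
  define T where "T = cadjoint A \<circ> A"
  have T: "T x = cadjoint A (A x)" for x by (simp add: T_def)
  have adj: "cinner x (T y) = cinner (A x) (A y)" for x y
    by (simp add: T cinner_cadjoint[OF A])
  have "cinner (T x) y = cinner (A x) (A y)" for x y
    by (metis adj cinner_commute)
  moreover have "bounded_clinear T"
    unfolding T_def comp_def by (intro bounded_clinear_comp[OF bounded_clinear_cadjoint] A)
  ultimately have sa: "self_adjoint T" by (simp add: self_adjoint_def adj)
  have "0 \<le> Re (cinner (T x) x)" for x
    unfolding self_adjoint_cinner[OF sa] adj norm_sq_Re[symmetric] by simp
  from positive_continuous_calculus[OF sa this, of "1/2"]
  interpret continuous_calculus T "\<lambda>t. t powr (1/2)" 0 "onorm T" by simp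
  have abs: "op_abs A = cfc (\<lambda>t. t powr (1/2)) T"
    by (simp add: op_abs_def op_powr_def T_def)
  show "self_adjoint (op_abs A)" unfolding abs by (rule self_adjoint_cfc)
  show "0 \<le> Re (cinner (op_abs A x) x)"
    using poly_op_le_cfc[of 0 x] unfolding abs by simp
  show "op_abs A (op_abs A x) = cadjoint A (A x)"
    unfolding abs T[symmetric]
    by (rule cfc_square_root) (simp add: powr_half_sqrt flip: powr_add)
qed

lemma bounded_clinear_op_powr:
  fixes P :: "'a::complex_hilbert_space \<Rightarrow> 'a"
  assumes "self_adjoint P" "\<And>x. 0 \<le> Re (cinner (P x) x)" "s > 0"
  shows "bounded_clinear (op_powr P s)"
  using continuous_calculus.bounded_clinear_cfc[OF positive_continuous_calculus[OF assms]]
  by (simp add: op_powr_def)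

text \<open>The polynomial in the proof is the tangent of \<open>t \<mapsto> t powr r\<close> at
  \<open>l = \<langle>P\<^sup>4 x, x\<rangle>\<close>, evaluated at \<open>t\<^sup>4\<close>.\<close>

lemma McCarthy:
  fixes P :: "'a::complex_hilbert_space \<Rightarrow> 'a"
  assumes P: "self_adjoint P" "\<And>x. 0 \<le> Re (cinner (P x) x)" and "r \<ge> 1" and x: "norm x = 1"
  shows "((norm (P (P x)))\<^sup>2) powr r \<le> Re (cinner (op_powr P (4 * r) x) x)"
proof -
  interpret continuous_calculus P "\<lambda>t. t powr (4 * r)" 0 "onorm P"
    using positive_continuous_calculus[OF P] \<open>r \<ge> 1\<close> by simp
  define l where "l = (norm (P (P x)))\<^sup>2"
  have "l \<ge> 0" by (simp add: l_def)
  define m where "m = r * l powr (r - 1)"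
  define q where "q = [:l powr r - m * l:] + monom m 4"
  have "poly q t \<le> t powr (4 * r)" if "t \<in> real_spectrum P" for t
  proof -
    have "t \<ge> 0" using that spectrum by auto
    have "poly q t = l powr r + m * (t ^ 4 - l)"
      by (simp add: q_def poly_monom algebra_simps)
    also have "\<dots> \<le> (t ^ 4) powr r"
      unfolding m_def by (rule powr_above_tangent[OF \<open>r \<ge> 1\<close> \<open>l \<ge> 0\<close>]) simp
    also have "\<dots> = t powr (4 * r)"
      using \<open>t \<ge> 0\<close> by (cases "t = 0") (simp_all add: powr_powr flip: powr_numeral)
    finally show ?thesis .
  qed
  from poly_op_le_cfc[OF this, of x]
  have "Re (cinner (poly_op q P x) x) \<le> Re (cinner (op_powr P (4 * r) x) x)"
    by (simp add: op_powr_def)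
  moreover have "poly_op q P x = (l powr r - m * l) *\<^sub>R x + m *\<^sub>R P (P (P (P x)))"
    unfolding q_def poly_op_add[OF lin] poly_op_monom
    by (simp add: lin linear_0[OF lin] numeral_eq_Suc)
  \<comment> \<open>The tangent is thus evaluated at its point of contact, where its value is
    \<open>l powr r\<close>.\<close>
  moreover have "Re (cinner (P (P (P (P x)))) x) = l"
    by (simp add: self_adjoint_cinner[OF P(1)] l_def norm_sq_Re)
  ultimately show ?thesis
    using x by (simp add: cinner_algebra cinner_self l_def)
qed

section \<open>Numerical radius\<close>

lemma numerical_radius_upper:
  assumes T: "bounded_clinear T" and x: "norm x = 1"
  shows "cmod (cinner (T x) x) \<le> numerical_radius T"
  unfolding numerical_radius_def
proof (rule cSup_upper)
  show "bdd_above (insert 0 {cmod (cinner (T x) x) |x. norm x = 1})"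
  proof (rule bdd_aboveI)
    fix y assume "y \<in> insert 0 {cmod (cinner (T x) x) |x. norm x = 1}"
    moreover have "cmod (cinner (T x) x) \<le> onorm T" if "norm x = 1" for x
      using order_trans[OF cinner_Cauchy_Schwarz, of "T x" x] bounded_clinear_norm[OF T, of x] that
      by simp
    ultimately show "y \<le> onorm T" using bounded_clinear_onorm_pos[OF T] by auto
  qed
qed (use x in blast)

lemma numerical_radius_nonneg:
  assumes T: "bounded_clinear T"
  shows "0 \<le> numerical_radius T"
  unfolding numerical_radius_def
proof (rule cSup_upper)
  show "bdd_above (insert 0 {cmod (cinner (T x) x) |x. norm x = 1})"
    using numerical_radius_upper[OF T]
    by (intro bdd_aboveI[of _ "max 0 (numerical_radius T)"]) fastforce
qed simp

text \<open>The supremum is taken before the power, so the bound is carried through the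
  \<open>s\<close>-th root; \<open>R powr (1 / s)\<close> also dominates the inserted 0.\<close>

lemma numerical_radius_powr_le:
  assumes "s > 0" "R \<ge> 0" and R: "\<And>x. norm x = 1 \<Longrightarrow> cmod (cinner (T x) x) powr s \<le> R"
    and T: "bounded_clinear T"
  shows "numerical_radius T powr s \<le> R"
proof -
  have "cmod (cinner (T x) x) \<le> R powr (1 / s)" if "norm x = 1" for x
    using powr_mono2[OF _ _ R[OF that], of "1 / s"] \<open>s > 0\<close> by (simp add: powr_powr)
  then have "numerical_radius T \<le> R powr (1 / s)"
    unfolding numerical_radius_def by (intro cSup_least) auto
  then have "numerical_radius T powr s \<le> (R powr (1 / s)) powr s"
    using \<open>s > 0\<close> numerical_radius_nonneg[OF T] by (intro powr_mono2) auto
  then show ?thesis using \<open>s > 0\<close> \<open>R \<ge> 0\<close> by (simp add: powr_powr)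
qed

lemma cinner_powr_le:
  fixes A B :: "'a::complex_hilbert_space \<Rightarrow> 'a"
  assumes A: "bounded_clinear A" and B: "bounded_clinear B" and "r \<ge> 1" and x: "norm x = 1"
  shows "cmod (cinner (B x) (A x)) powr (2 * r)
    \<le> (Re (cinner (op_powr (op_abs A) (4 * r) x) x) + Re (cinner (op_powr (op_abs B) (4 * r) x) x)) / 4
      + numerical_radius ((op_abs B ^^ 2) \<circ> (op_abs A ^^ 2)) powr r / 2"
proof -
  let ?P = "op_abs A" and ?Q = "op_abs B"
  note P = self_adjoint_op_abs[OF A] op_abs_nonneg[OF A]
  note Q = self_adjoint_op_abs[OF B] op_abs_nonneg[OF B]
  define u where "u = ?P (?P x)"
  define v where "v = ?Q (?Q x)"
  define W where "W = (?Q ^^ 2) \<circ> (?P ^^ 2)"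
  define w where "w = numerical_radius W"
  have W: "W = (\<lambda>x. ?Q (?Q (?P (?P x))))" by (simp add: W_def fun_eq_iff numeral_2_eq_2)
  have bP: "bounded_clinear ?P" and bQ: "bounded_clinear ?Q"
    using P Q by (auto intro: self_adjoint_bounded)
  have bW: "bounded_clinear W"
    unfolding W by (rule bounded_clinear_comp[OF bQ] bounded_clinear_comp[OF bP] bP)+
  \<comment> \<open>Moving the two factors \<open>op_abs B\<close> across the inner product produces
    exactly the composition in the numerical radius.\<close>
  have "cinner u v = cinner (W x) x"
    by (simp add: W u_def v_def self_adjoint_cinner[OF Q(1)])
  then have uv: "cmod (cinner u v) \<le> w"
    using numerical_radius_upper[OF bW x] by (simp add: w_def)
  have "w \<ge> 0" using numerical_radius_nonneg[OF bW] by (simp add: w_def)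
  have xv: "cinner x v = of_real ((norm (B x))\<^sup>2)"
    by (simp only: v_def op_abs_square[OF B] cinner_cadjoint[OF B, symmetric] cinner_self)
  have "cinner x u = of_real ((norm (A x))\<^sup>2)"
    by (simp only: u_def op_abs_square[OF A] cinner_cadjoint[OF A, symmetric] cinner_self)
  then have ux: "cinner u x = of_real ((norm (A x))\<^sup>2)"
    by (metis cinner_commute complex_cnj_complex_of_real)
  \<comment> \<open>Squaring first makes the Cauchy--Schwarz bound a product of two inner products
    with \<open>x\<close>, the form that Buzano's inequality handles.\<close>
  have "(cmod (cinner (B x) (A x)))\<^sup>2 \<le> (norm (B x) * norm (A x))\<^sup>2"
    by (intro power_mono cinner_Cauchy_Schwarz) simp
  also have "\<dots> = cmod (cinner u x * cinner x v)"
    unfolding ux xv norm_mult norm_of_real by (simp add: power_mult_distrib)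
  also have "\<dots> \<le> (norm u * norm v + w) / 2" using Buzano[OF x, of u v] uv by simp
  finally have "((cmod (cinner (B x) (A x)))\<^sup>2) powr r \<le> ((norm u * norm v + w) / 2) powr r"
    using \<open>r \<ge> 1\<close> by (intro powr_mono2) auto
  also have "\<dots> \<le> ((norm u * norm v) powr r + w powr r) / 2"
    using \<open>w \<ge> 0\<close> by (intro powr_midpoint_le \<open>r \<ge> 1\<close>) auto
  finally have 1: "((cmod (cinner (B x) (A x)))\<^sup>2) powr r
    \<le> (norm u * norm v) powr r / 2 + w powr r / 2" by (simp add: add_divide_distrib)
  \<comment> \<open>AM-GM separates \<open>u\<close> from \<open>v\<close> and produces the squares
    that McCarthy's inequality bounds.\<close>
  have "norm u * norm v \<le> ((norm u)\<^sup>2 + (norm v)\<^sup>2) / 2"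
    using zero_le_power2[of "norm u - norm v"] unfolding power2_diff by simp
  then have "(norm u * norm v) powr r \<le> (((norm u)\<^sup>2 + (norm v)\<^sup>2) / 2) powr r"
    using \<open>r \<ge> 1\<close> by (intro powr_mono2) auto
  also have "\<dots> \<le> (((norm u)\<^sup>2) powr r + ((norm v)\<^sup>2) powr r) / 2"
    by (intro powr_midpoint_le \<open>r \<ge> 1\<close>) auto
  finally have 2: "(norm u * norm v) powr r \<le> (((norm u)\<^sup>2) powr r + ((norm v)\<^sup>2) powr r) / 2" .
  have 3: "((norm u)\<^sup>2) powr r \<le> Re (cinner (op_powr ?P (4 * r) x) x)"
    unfolding u_def by (rule McCarthy[OF P \<open>r \<ge> 1\<close> x])
  have 4: "((norm v)\<^sup>2) powr r \<le> Re (cinner (op_powr ?Q (4 * r) x) x)"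
    unfolding v_def by (rule McCarthy[OF Q \<open>r \<ge> 1\<close> x])
  have "cmod (cinner (B x) (A x)) powr (2 * r) = ((cmod (cinner (B x) (A x)))\<^sup>2) powr r"
    by (simp add: powr_powr flip: powr_numeral)
  also have "\<dots> \<le> (((norm u)\<^sup>2) powr r + ((norm v)\<^sup>2) powr r) / 4 + w powr r / 2"
    using 1 2 by (simp add: field_simps)
  also have "\<dots> \<le> (Re (cinner (op_powr ?P (4 * r) x) x) + Re (cinner (op_powr ?Q (4 * r) x) x)) / 4
      + w powr r / 2"
    by (intro add_right_mono divide_right_mono add_mono 3 4) simp
  finally show ?thesis unfolding w_def W_def .
qed

theorem theorem2p21:
  fixes A B C D :: "'a::complex_hilbert_space \<Rightarrow> 'a" and r :: real
  assumes "bounded_clinear A" and "bounded_clinear B"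
    and "bounded_clinear C" and "bounded_clinear D"
    and "r \<ge> 1"
  shows "numerical_radius (\<lambda>x. (cadjoint A \<circ> B) x + (cadjoint C \<circ> D) x) powr (2 * r)
    \<le> 2 powr (2 * r - 3) *
        onorm (\<lambda>x. op_powr (op_abs A) (4 * r) x + op_powr (op_abs B) (4 * r) x
                 + op_powr (op_abs C) (4 * r) x + op_powr (op_abs D) (4 * r) x)
      + 2 powr (2 * r - 2) *
        (numerical_radius ((op_abs B ^^ 2) \<circ> (op_abs A ^^ 2)) powr r
       + numerical_radius ((op_abs D ^^ 2) \<circ> (op_abs C ^^ 2)) powr r)"
proof -
  define pw where "pw X = op_powr (op_abs X) (4 * r)" for X :: "'a \<Rightarrow> 'a"
  define w where "w X Y = numerical_radius ((op_abs Y ^^ 2) \<circ> (op_abs X ^^ 2)) powr r"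
    for X Y :: "'a \<Rightarrow> 'a"
  define S where "S x = pw A x + pw B x + pw C x + pw D x" for x
  define T where "T x = cadjoint A (B x) + cadjoint C (D x)" for x
  have pw: "bounded_clinear (pw X)" if "bounded_clinear X" for X :: "'a \<Rightarrow> 'a"
    unfolding pw_def using \<open>r \<ge> 1\<close>
    by (intro bounded_clinear_op_powr self_adjoint_op_abs op_abs_nonneg that) simp
  have S: "bounded_clinear S"
    unfolding S_def by (intro bounded_clinear_plus pw assms)
  have T: "bounded_clinear T"
    unfolding T_def
    by (intro bounded_clinear_plus bounded_clinear_comp[OF bounded_clinear_cadjoint] assms)
  define R where "R = 2 powr (2 * r - 3) * onorm S + 2 powr (2 * r - 2) * (w A B + w C D)"
  have "cmod (cinner (T x) x) powr (2 * r) \<le> R" if x: "norm x = 1" for x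
  proof -
    define a where "a = cmod (cinner (B x) (A x))"
    define b where "b = cmod (cinner (D x) (C x))"
    have adj: "cinner (cadjoint X (Y x)) x = cinner (Y x) (X x)" if "bounded_clinear X"
      for X Y :: "'a \<Rightarrow> 'a"
      using cinner_cadjoint[OF that, of x "Y x"] by (metis cinner_commute)
    have nonneg: "a \<ge> 0" "b \<ge> 0" by (simp_all add: a_def b_def)
    \<comment> \<open>Written as twice a mean, so that midpoint convexity applies; the 2 leaves as
      \<open>2 powr (2 * r)\<close>.\<close>
    have "cmod (cinner (T x) x) \<le> 2 * ((a + b) / 2)"
      unfolding T_def cinner_add_left adj[OF assms(1)] adj[OF assms(3)] a_def b_def
      using norm_triangle_ineq[of "cinner (B x) (A x)" "cinner (D x) (C x)"] by simp
    then have "cmod (cinner (T x) x) powr (2 * r) \<le> (2 * ((a + b) / 2)) powr (2 * r)"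
      using \<open>r \<ge> 1\<close> by (intro powr_mono2) auto
    also have "\<dots> = 2 powr (2 * r) * ((a + b) / 2) powr (2 * r)"
      by (rule powr_mult)
    also have "\<dots> \<le> 2 powr (2 * r) * ((a powr (2 * r) + b powr (2 * r)) / 2)"
      using nonneg \<open>r \<ge> 1\<close> by (intro mult_left_mono powr_midpoint_le) auto
    \<comment> \<open>The four quadratic forms are added before passing to the norm, which gives the
      norm of the sum and not a sum of norms.\<close>
    also have "\<dots> \<le> 2 powr (2 * r) * ((onorm S / 4 + (w A B + w C D) / 2) / 2)"
    proof -
      define h where "h X = Re (cinner (pw X x) x)" for X
      have "a powr (2 * r) + b powr (2 * r) \<le> ((h A + h B) / 4 + w A B / 2) + ((h C + h D) / 4 + w C D / 2)"
        unfolding a_def b_def h_def pw_def w_def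
        by (intro add_mono cinner_powr_le assms x)
      also have "\<dots> = (h A + h B + h C + h D) / 4 + (w A B + w C D) / 2"
        by (simp add: field_simps)
      also have "h A + h B + h C + h D = Re (cinner (S x) x)"
        by (simp add: S_def h_def cinner_add_left)
      also have "Re (cinner (S x) x) / 4 + (w A B + w C D) / 2 \<le> onorm S / 4 + (w A B + w C D) / 2"
        using abs_Re_cinner_le_onorm[OF S, of x] x by simp
      finally show ?thesis by (intro mult_left_mono divide_right_mono) simp_all
    qed
    also have "\<dots> = R"
    proof -
      \<comment> \<open>The 8 is \<open>4 * 2\<close> and the 4 is \<open>2 * 2\<close>: the
        denominators for a single pair times the 2 from the midpoint.\<close>
      have e: "2 powr (2 * r - 3) = 2 powr (2 * r) / (8::real)"
        "2 powr (2 * r - 2) = 2 powr (2 * r) / (4::real)"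
        by (simp_all add: powr_diff)
      show ?thesis unfolding R_def e by (simp add: field_simps)
    qed
    finally show ?thesis .
  qed
  moreover have "R \<ge> 0"
    using bounded_clinear_onorm_pos[OF S] by (simp add: R_def w_def)
  ultimately have "numerical_radius T powr (2 * r) \<le> R"
    using \<open>r \<ge> 1\<close> T by (intro numerical_radius_powr_le) auto
  then show ?thesis
    unfolding R_def S_def T_def pw_def w_def comp_apply .
qed

end
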